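(* Let $G$ be a simple connected planar graph in which every vertex has finite degree, with minimum degree at least $3$, and suppose $\kappa_{\mathrm{LLY}}(x,y)>0$ for every edge $xy\in E(G)$. Then $G$ is finite; in particular $|V(G)|\leq 17^{544}$.
   Context: For a vertex $x$ let $\Gamma(x)$ be its neighborhood and $d(x)=|\Gamma(x)|$; $d(\cdot,\cdot)$ denotes graph distance. For $0\le\alpha<1$ the $\alpha$-lazy random walk is $m_x^{\alpha}(x)=\alpha$, $m_x^{\alpha}(v)=(1-\alpha)/d(x)$ for $v\in\Gamma(x)$, and $0$ otherwise. For probability measures $m_1,m_2$ with finite support, $W(m_1,m_2)=\inf_A\sum_{u,v}A(u,v)d(u,v)$, the infimum over couplings $A$ of $m_1,m_2$. Set $\kappa_\alpha(x,y)=1-W(m_x^\alpha,m_y^\alpha)/d(x,y)$ and the Lin–Lu–Yau Ricci curvature $\kappa_{\mathrm{LLY}}(x,y)=\lim_{\alpha\to1}\kappa_\alpha(x,y)/(1-\alpha)$. *)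

theory Defs
  imports "HOL-Probability.Probability"
begin

text \<open>
  A simple undirected graph, possibly infinite, is a vertex set together with a symmetric
  irreflexive adjacency relation; the edge \<open>xy\<close> is present as both \<open>(x, y)\<close> and \<open>(y, x)\<close>.
\<close>

definition simple_graph :: "'a set \<Rightarrow> 'a rel \<Rightarrow> bool" where
  "simple_graph V E \<longleftrightarrow> E \<subseteq> V \<times> V \<and> sym E \<and> irrefl E"

definition connected_graph :: "'a set \<Rightarrow> 'a rel \<Rightarrow> bool" where
  "connected_graph V E \<longleftrightarrow> (\<forall>x\<in>V. \<forall>y\<in>V. (x, y) \<in> E\<^sup>*)"

definition neighborhood :: "'a rel \<Rightarrow> 'a \<Rightarrow> 'a set" where
  "neighborhood E x = E `` {x}"

definition vertex_degree :: "'a rel \<Rightarrow> 'a \<Rightarrow> nat" where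
  "vertex_degree E x = card (neighborhood E x)"

text \<open>
  \<open>E ^^ n\<close> relates the endpoints of walks of length \<open>n\<close>. The value is meaningful only for
  vertices in the same component.
\<close>

definition graph_dist :: "'a rel \<Rightarrow> 'a \<Rightarrow> 'a \<Rightarrow> nat" where
  "graph_dist E x y = (LEAST n. (x, y) \<in> E ^^ n)"

text \<open>
  A planar drawing places the vertices at distinct points \<open>p x\<close> of the plane and each edge along
  an arc \<open>c {x, y}\<close> joining its two ends (in either direction), such that an arc passes through no
  vertex other than its ends and two different arcs meet at most in the images of common ends.
  For infinite graphs nothing is required about accumulation points of the drawing.
\<close>

definition planar_drawing ::
    "'a set \<Rightarrow> 'a rel \<Rightarrow> ('a \<Rightarrow> complex) \<Rightarrow> ('a set \<Rightarrow> real \<Rightarrow> complex) \<Rightarrow> bool" where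
  "planar_drawing V E p c \<longleftrightarrow>
     inj_on p V \<and>
     (\<forall>(x, y)\<in>E. arc (c {x, y}) \<and> {pathstart (c {x, y}), pathfinish (c {x, y})} = {p x, p y}) \<and>
     (\<forall>(x, y)\<in>E. path_image (c {x, y}) \<inter> p ` V = {p x, p y}) \<and>
     (\<forall>(x, y)\<in>E. \<forall>(u, v)\<in>E. {x, y} \<noteq> {u, v} \<longrightarrow>
        path_image (c {x, y}) \<inter> path_image (c {u, v}) \<subseteq> p ` ({x, y} \<inter> {u, v}))"

definition planar_graph :: "'a set \<Rightarrow> 'a rel \<Rightarrow> bool" where
  "planar_graph V E \<longleftrightarrow> (\<exists>p c. planar_drawing V E p c)"

definition lazy_walk_mass :: "'a rel \<Rightarrow> real \<Rightarrow> 'a \<Rightarrow> 'a \<Rightarrow> real" where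
  "lazy_walk_mass E \<alpha> x v =
     (if v = x then \<alpha>
      else if v \<in> neighborhood E x then (1 - \<alpha>) / real (vertex_degree E x)
      else 0)"

definition lazy_walk :: "'a rel \<Rightarrow> real \<Rightarrow> 'a \<Rightarrow> 'a pmf" where
  "lazy_walk E \<alpha> x = embed_pmf (lazy_walk_mass E \<alpha> x)"

text \<open>The masses do form a probability distribution, so that \<^const>\<open>embed_pmf\<close> is meaningful:\<close>

lemma pmf_lazy_walk:
  assumes "irrefl E" "finite (neighborhood E x)" "neighborhood E x \<noteq> {}" "0 \<le> \<alpha>" "\<alpha> < 1"
  shows "pmf (lazy_walk E \<alpha> x) v = lazy_walk_mass E \<alpha> x v"
proof -
  let ?f = "lazy_walk_mass E \<alpha> x" and ?N = "neighborhood E x"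
  have x: "x \<notin> ?N"
    using assms(1) by (auto simp: neighborhood_def irrefl_def)
  have nonneg: "0 \<le> ?f u" for u
    using assms(4,5) by (simp add: lazy_walk_mass_def)
  have "(\<integral>\<^sup>+u. ennreal (?f u) \<partial>count_space UNIV) = (\<Sum>u\<in>insert x ?N. ennreal (?f u))"
    by (rule nn_integral_count_space') (use assms(2) in \<open>auto simp: lazy_walk_mass_def\<close>)
  also have "\<dots> = ennreal (\<Sum>u\<in>insert x ?N. ?f u)"
    using nonneg by (intro sum_ennreal) auto
  also have "(\<Sum>u\<in>insert x ?N. ?f u) = ?f x + (\<Sum>u\<in>?N. ?f u)"
    using x assms(2) by simp
  also have "(\<Sum>u\<in>?N. ?f u) = (\<Sum>u\<in>?N. (1 - \<alpha>) / real (card ?N))"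
    using x by (intro sum.cong) (auto simp: lazy_walk_mass_def vertex_degree_def)
  also have "?f x + \<dots> = \<alpha> + (\<Sum>u\<in>?N. (1 - \<alpha>) / real (card ?N))"
    by (simp add: lazy_walk_mass_def)
  also have "\<dots> = 1"
    using assms(2,3) by simp
  finally show ?thesis
    unfolding lazy_walk_def using nonneg by (intro pmf_embed_pmf) auto
qed

definition couplings :: "'a pmf \<Rightarrow> 'a pmf \<Rightarrow> ('a \<times> 'a) pmf set" where
  "couplings m\<^sub>1 m\<^sub>2 = {A. map_pmf fst A = m\<^sub>1 \<and> map_pmf snd A = m\<^sub>2}"

text \<open>
  Intended for finitely supported \<open>m\<^sub>1\<close>, \<open>m\<^sub>2\<close>: then every coupling is finitely supported and the
  expectation is the finite sum of \<open>A(u, v) d(u, v)\<close>.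
\<close>

definition wasserstein :: "'a rel \<Rightarrow> 'a pmf \<Rightarrow> 'a pmf \<Rightarrow> real" where
  "wasserstein E m\<^sub>1 m\<^sub>2 =
     (INF A\<in>couplings m\<^sub>1 m\<^sub>2. measure_pmf.expectation A (\<lambda>(u, v). real (graph_dist E u v)))"

definition lazy_curvature :: "'a rel \<Rightarrow> real \<Rightarrow> 'a \<Rightarrow> 'a \<Rightarrow> real" where
  "lazy_curvature E \<alpha> x y =
     1 - wasserstein E (lazy_walk E \<alpha> x) (lazy_walk E \<alpha> y) / real (graph_dist E x y)"

definition LLY_curvature :: "'a rel \<Rightarrow> 'a \<Rightarrow> 'a \<Rightarrow> real" where
  "LLY_curvature E x y = Lim (at_left 1) (\<lambda>\<alpha>. lazy_curvature E \<alpha> x y / (1 - \<alpha>))"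

end

theory Submission
  imports Defs
begin

text \<open>
  Weak duality bounds the curvature of an edge \<open>vu\<close> by \<open>L f u - L f v\<close>, where \<open>L\<close> is the graph Laplacian and
  \<open>f\<close> any 1-Lipschitz function with \<open>f v = f u + 1\<close>. Hence positive curvature makes \<open>L f\<close> drop strictly along
  such edges.

  Degrees are at most 24. Let \<open>x\<close> have degree at least 25. Testing with the truncated distance to subsets of the
  neighbourhood of a neighbour \<open>y\<close> of \<open>x\<close> shows that every set \<open>B\<close> of neighbours of \<open>y\<close> dominates a
  proportion of about \<open>card B / deg y\<close> of the neighbours of \<open>x\<close>. Among the cycles of length 3 or 4 through \<open>x\<close>
  choose one with an inclusion-minimal side containing at least three neighbours of \<open>x\<close>. By minimality and
  the Jordan curve theorem, each vertex in this side is adjacent to at most two neighbours of \<open>x\<close>, so by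
  domination the neighbours of \<open>x\<close> in this side have all their edges to the cycle, and planarity
  leaves room for only two of them.

  For \<open>f\<close> the distance from a fixed vertex, \<open>L f\<close> is a fraction with denominator the degree, so it drops
  by at least \<open>1 / k\<^sup>2\<close> with each step away, where \<open>k = 24\<close>. It starts at most 1 and never falls below \<open>-1\<close>,
  which bounds the diameter by \<open>2 k\<^sup>2\<close>; and it bounds the growth of successive spheres, which yields at most
  about \<open>2 k\<^sup>3 (k!)\<^sup>k\<close> vertices.
\<close>

subsection \<open>Theta curves\<close>

text \<open>The drawing may be infinite and may accumulate, so the planarity argument uses no faces
  and no Euler-type count. It sees only short cycles through one vertex, finitely many by local
  finiteness, which is why an inclusion-minimal side exists. The topological input is that of three
  arcs with common ends one lies between the other two, as seen from a reference point.

  The threshold 25 comes from the domination inequalities, which must exclude any further edge of a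
  vertex. The tightest have the form \<open>d * b < 6 * (b + 3)\<close> with \<open>d\<close> the
  degree of \<open>x\<close>, and at \<open>b = 1\<close> they would need \<open>d < 24\<close>.

  Degree and diameter alone would only give about 24^1152 vertices, far beyond 17^544. The count
  therefore follows the number of edges between consecutive spheres. Its growth factor from distance
  r to r + 1 is about 1 + (k^2 - r) / k, which decreases to 1 at r = k^2, and the rounded factors
  multiply to (k!)^k.

  Since the curvature is defined by \<open>Lim\<close>, a bound on the quotients says nothing until
  the limit is known to exist. This is why monotonicity in \<alpha> is proved besides weak
  duality.\<close>

definition arc_between :: "complex set \<Rightarrow> complex \<Rightarrow> complex \<Rightarrow> bool" where
  "arc_between A s t \<longleftrightarrow> (\<exists>g. arc g \<and> pathstart g = s \<and> pathfinish g = t \<and> path_image g = A)"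

lemma arc_betweenE:
  assumes "arc_between A s t"
  obtains g where "arc g" "pathstart g = s" "pathfinish g = t" "path_image g = A"
  using assms unfolding arc_between_def by blast

lemma arc_between_sym: "arc_between A s t \<Longrightarrow> arc_between A t s"
  unfolding arc_between_def
  by (metis arc_reversepath path_image_reversepath pathfinish_reversepath pathstart_reversepath)

lemma arc_between_join:
  assumes "arc_between A s t" "arc_between B t u" "A \<inter> B \<subseteq> {t}"
  shows "arc_between (A \<union> B) s u"
proof -
  obtain g where g: "arc g" "pathstart g = s" "pathfinish g = t" "path_image g = A"
    using assms(1) by (rule arc_betweenE)
  obtain h where h: "arc h" "pathstart h = t" "pathfinish h = u" "path_image h = B"
    using assms(2) by (rule arc_betweenE)
  have "arc (g +++ h)" using g h assms(3) by (intro arc_join) auto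
  then show ?thesis unfolding arc_between_def using g h
    by (intro exI[of _ "g +++ h"]) (auto simp: path_image_join)
qed

lemma arc_between_facts:
  assumes "arc_between A s t"
  shows "compact A" "connected A" "s \<in> A" "t \<in> A" "s \<noteq> t" "closed A"
proof -
  obtain g where g: "arc g" "pathstart g = s" "pathfinish g = t" "path_image g = A"
    using assms by (rule arc_betweenE)
  show "compact A" "connected A" "s \<in> A" "t \<in> A" "s \<noteq> t" "closed A"
    using arc_distinct_ends[OF g(1)] compact_arc_image[OF g(1)] connected_arc_image[OF g(1)]
      closed_arc_image[OF g(1)] pathstart_in_path_image[of g] pathfinish_in_path_image[of g]
    unfolding g(2-4) by (simp_all only:)
qed

lemma arc_between_open_end:
  assumes "arc_between A s t"
  shows "connected (A - {t})"
proof -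
  obtain g where g: "arc g" "pathstart g = s" "pathfinish g = t" "path_image g = A"
    using assms by (rule arc_betweenE)
  have inj: "inj_on g {0..1}" and cont: "continuous_on {0..1} g"
    using g(1) by (auto simp: arc_def path_def)
  have "A - {t} = g ` ({0..1} - {1})"
    using inj_on_image_set_diff[OF inj, of "{0..1}" "{1}"] g(3,4)
    by (simp add: path_image_def pathfinish_def)
  also have "{0..1} - {1} = {0..<1::real}" by auto
  finally have "A - {t} = g ` {0..<1}" .
  moreover have "continuous_on {0..<1} g" by (rule continuous_on_subset[OF cont]) auto
  ultimately show ?thesis by (simp add: connected_continuous_image)
qed

lemma arc_between_interior:
  assumes "arc_between A s t"
  shows "connected (A - {s, t})" "A - {s, t} \<noteq> {}"
proof -
  obtain g where g: "arc g" "pathstart g = s" "pathfinish g = t" "path_image g = A"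
    using assms by (rule arc_betweenE)
  have sp: "simple_path g" using g(1) by (rule arc_imp_simple_path)
  show "connected (A - {s, t})" "A - {s, t} \<noteq> {}"
    using connected_simple_path_endless[OF sp] nonempty_simple_path_endless[OF sp]
    unfolding g(2-4) by simp_all
qed

text \<open>
  The interior of a cycle is measured relative to a reference point \<open>a\<close> rather than to infinity, so that
  a region on either side of a given cycle can be treated as its interior.
\<close>

definition far_side :: "complex \<Rightarrow> complex set \<Rightarrow> complex set" where
  "far_side a J = {z. z \<notin> J \<and> \<not> connected_component (- J) a z}"

lemma far_side_disjoint: "far_side a J \<inter> J = {}"
  by (auto simp: far_side_def)

lemma ref_notin_far_side: "a \<notin> far_side a J"
  by (auto simp: far_side_def)

lemma connected_subset_far_side:
  assumes "connected K" "K \<inter> J = {}" "z \<in> K" "z \<in> far_side a J"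
  shows "K \<subseteq> far_side a J"
proof
  fix w assume "w \<in> K"
  have "connected_component (- J) z w"
    by (rule connected_componentI[OF assms(1)]) (use assms \<open>w \<in> K\<close> in auto)
  then show "w \<in> far_side a J"
    using assms(4) \<open>w \<in> K\<close> assms(2) connected_component_trans[of "- J" a w z] connected_component_sym[of "- J" z w]
    unfolding far_side_def by blast
qed

definition jordan :: "complex set \<Rightarrow> bool" where
  "jordan J \<longleftrightarrow> (\<exists>g. simple_path g \<and> pathfinish g = pathstart g \<and> path_image g = J)"

lemma jordan_arcs:
  assumes "arc_between P s t" "arc_between Q s t" "P \<inter> Q \<subseteq> {s, t}"
  shows "jordan (P \<union> Q)"
proof -
  obtain g where g: "arc g" "pathstart g = s" "pathfinish g = t" "path_image g = P"
    using assms(1) by (rule arc_betweenE)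
  obtain h where h: "arc h" "pathstart h = t" "pathfinish h = s" "path_image h = Q"
    using arc_between_sym[OF assms(2)] by (rule arc_betweenE)
  have "simple_path (g +++ h)"
    using g h assms(3) by (intro simple_path_join_loop) auto
  then show ?thesis unfolding jordan_def using g h
    by (intro exI[of _ "g +++ h"]) (auto simp: path_image_join)
qed

text \<open>The Jordan curve theorem splits the complement into two open connected sets, which are
  therefore its components. Since \<open>a\<close> may lie in either, the far side may be the
  unbounded one. The last claim exchanges the two sides by moving the reference point across the
  curve.\<close>

lemma jordan_far_side:
  assumes "jordan J" "a \<notin> J"
  shows "open (far_side a J)" "connected (far_side a J)" "frontier (far_side a J) = J"
    "far_side a J \<noteq> {}"
    "frontier (connected_component_set (- J) a) = J"
    "far_side a J = - J - connected_component_set (- J) a"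
    "\<And>b. b \<in> far_side a J \<Longrightarrow> far_side b J = connected_component_set (- J) a"
proof -
  obtain c where c: "simple_path c" "pathfinish c = pathstart c" "path_image c = J"
    using assms(1) unfolding jordan_def by blast
  note J = Jordan_inside_outside[OF c(1,2), unfolded c(3)]
  have "a \<in> inside J \<or> a \<in> outside J" using J assms(2) by blast
  then obtain U W where UW: "U = inside J \<and> W = outside J \<or> U = outside J \<and> W = inside J" "a \<in> U"
    by blast
  have o: "open U" "open W" and co: "connected U" "connected W" and dis: "U \<inter> W = {}"
    and un: "U \<union> W = - J" and fr: "frontier U = J" "frontier W = J" and ne: "W \<noteq> {}"
    using J UW(1) by (auto simp only: Un_commute Int_commute)
  have comp: "connected_component_set (- J) z = A"
    if A: "open A" "open B" "connected A" "A \<inter> B = {}" "A \<union> B = - J" "z \<in> A" for A B z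
  proof
    show "A \<subseteq> connected_component_set (- J) z"
      by (rule connected_component_maximal) (use A in auto)
    have "connected_component_set (- J) z \<subseteq> A \<union> B"
      unfolding A(5) by (rule connected_component_subset)
    moreover have "z \<in> connected_component_set (- J) z" using A(5,6) by auto
    ultimately show "connected_component_set (- J) z \<subseteq> A"
      using connectedD[OF connected_connected_component A(1,2), of "- J" z] A(4,6) by blast
  qed
  have fs: "far_side z J = - J - connected_component_set (- J) z" for z
    by (auto simp: far_side_def)
  have a: "connected_component_set (- J) a = U" by (rule comp[OF o co(1) dis un UW(2)])
  have fsa: "far_side a J = W" unfolding fs a using dis un by blast
  show "open (far_side a J)" "connected (far_side a J)" "frontier (far_side a J) = J"
    "far_side a J \<noteq> {}" "frontier (connected_component_set (- J) a) = J"
    unfolding a fsa using o co fr ne by auto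
  show "far_side a J = - J - connected_component_set (- J) a" by (rule fs)
  fix b assume "b \<in> far_side a J"
  then have "b \<in> W" by (simp only: fsa)
  then have "connected_component_set (- J) b = W"
    by (intro comp[of W U]) (use o co dis un in auto)
  then show "far_side b J = connected_component_set (- J) a" unfolding fs a using dis un by blast
qed

lemma closure_far_side:
  assumes "jordan J" "a \<notin> J"
  shows "closure (far_side a J) = far_side a J \<union> J"
  using jordan_far_side(3)[OF assms] by (simp add: closure_Un_frontier)

text \<open>The component of \<open>a\<close> off \<open>J\<close> is connected, contains
  \<open>a\<close> and misses \<open>J'\<close>, so it misses the far side of \<open>J'\<close>.
  That far side is open, so it also misses the closure of the component, which contains
  \<open>J\<close>.\<close>

lemma far_side_nested:
  assumes J: "jordan J" "a \<notin> J" and J': "J' \<subseteq> J \<union> far_side a J" "jordan J'"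
  shows "far_side a J' \<subseteq> far_side a J"
proof -
  let ?O = "connected_component_set (- J) a"
  have dis: "?O \<inter> J' = {}"
    using J' connected_component_subset[of "- J" a] unfolding far_side_def by auto
  have aO: "a \<in> ?O" using J(2) by (simp add: connected_component_refl_eq)
  have a': "a \<notin> J'" using aO dis by blast
  have "?O \<subseteq> far_side a J'" if "z \<in> ?O" "z \<in> far_side a J'" for z
    by (rule connected_subset_far_side[OF connected_connected_component dis that])
  then have "?O \<inter> far_side a J' = {}"
    using aO ref_notin_far_side[of a J'] by blast
  then have "closure ?O \<inter> far_side a J' = {}"
    using open_Int_closure_eq_empty[OF jordan_far_side(1)[OF J'(2) a'], of ?O] by (simp add: Int_commute)
  moreover have "J \<subseteq> closure ?O" using jordan_far_side(5)[OF J] by (auto simp: frontier_def)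
  ultimately show ?thesis
    using jordan_far_side(6)[OF J] closure_subset[of ?O] by blast
qed

section \<open>Three arcs with common ends\<close>

locale theta =
  fixes P Q R :: "complex set" and s t a :: complex
  assumes arcs: "arc_between P s t" "arc_between Q s t" "arc_between R s t"
    and disj: "P \<inter> Q \<subseteq> {s, t}" "P \<inter> R \<subseteq> {s, t}" "Q \<inter> R \<subseteq> {s, t}"
    and ref: "a \<notin> P" "a \<notin> Q" "a \<notin> R"
begin

lemma jordans: "jordan (P \<union> Q)" "jordan (P \<union> R)" "jordan (Q \<union> R)"
  using jordan_arcs[OF arcs(1,2) disj(1)] jordan_arcs[OF arcs(1,3) disj(2)] jordan_arcs[OF arcs(2,3) disj(3)] .

text \<open>This is Janiszewski's theorem: the curves \<open>P \<union> R\<close> and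
  \<open>Q \<union> R\<close> meet in the connected set \<open>R\<close>, so if neither separates
  \<open>z\<close> from \<open>a\<close>, then their union does not either.\<close>

lemma split: "far_side a (P \<union> Q) \<subseteq> far_side a (P \<union> R) \<union> far_side a (Q \<union> R) \<union> R"
proof
  fix z assume z: "z \<in> far_side a (P \<union> Q)"
  show "z \<in> far_side a (P \<union> R) \<union> far_side a (Q \<union> R) \<union> R"
  proof (rule ccontr)
    assume "\<not> ?thesis"
    then have "z \<notin> far_side a (P \<union> R)" "z \<notin> far_side a (Q \<union> R)" "z \<notin> R" by blast+
    then have "connected_component (- (P \<union> R)) a z" "connected_component (- (Q \<union> R)) a z"
      using z by (simp_all add: far_side_def)
    moreover have "(P \<union> R) \<inter> (Q \<union> R) = R"
      using disj arc_between_facts[OF arcs(3)] by auto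
    ultimately have "connected_component (- ((P \<union> R) \<union> (Q \<union> R))) a z"
      using arc_between_facts[OF arcs(1)] arc_between_facts[OF arcs(2)] arc_between_facts[OF arcs(3)]
      by (intro Janiszewski[of "P \<union> R" "Q \<union> R"]) (simp_all add: closed_Un compact_Un del: Compl_Un)
    then have "connected_component (- (P \<union> Q)) a z"
      by (rule connected_component_of_subset) auto
    then show False using z by (simp add: far_side_def)
  qed
qed

lemma interior_dichotomy:
  "R - {s, t} \<subseteq> far_side a (P \<union> Q) \<or> R \<inter> far_side a (P \<union> Q) = {}"
proof -
  have "(R - {s,t}) \<inter> (P \<union> Q) = {}" using disj by auto
  moreover have "{s,t} \<inter> far_side a (P \<union> Q) = {}"
    using far_side_disjoint[of a "P \<union> Q"] arc_between_facts[OF arcs(1)] by auto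
  moreover have "R - {s, t} \<subseteq> far_side a (P \<union> Q)"
    if "z \<in> R - {s, t}" "z \<in> far_side a (P \<union> Q)" for z
    by (rule connected_subset_far_side[OF arc_between_interior(1)[OF arcs(3)] calculation(1) that])
  ultimately show ?thesis by blast
qed

lemma swap12: "theta Q P R s t a" and swap23: "theta P R Q s t a"
  using arcs disj ref by unfold_locales auto

end

text \<open>If \<open>R\<close> avoids the far side of \<open>P \<union> Q\<close>, that side is
  connected and misses all three arcs, so by \<open>split\<close> it lies in the far side of
  \<open>P \<union> R\<close> or of \<open>Q \<union> R\<close>. Passing to closures brings the
  third arc along.\<close>

lemma (in theta) middle:
  "R - {s, t} \<subseteq> far_side a (P \<union> Q) \<or> Q - {s, t} \<subseteq> far_side a (P \<union> R) \<or> P - {s, t} \<subseteq> far_side a (Q \<union> R)"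
proof (cases "R - {s, t} \<subseteq> far_side a (P \<union> Q)")
  case False
  let ?U = "far_side a (P \<union> Q)"
  have aPQ: "a \<notin> P \<union> Q" using ref by auto
  note U = jordan_far_side[OF jordans(1) aPQ]
  have R: "R \<inter> ?U = {}" using interior_dichotomy False by blast
  obtain z where z: "z \<in> ?U" using U(4) by blast
  have dis: "?U \<inter> (P \<union> R) = {}" "?U \<inter> (Q \<union> R) = {}"
    using R far_side_disjoint[of a "P \<union> Q"] by auto
  have "z \<in> far_side a (P \<union> R) \<or> z \<in> far_side a (Q \<union> R)" using split R z by blast
  then consider "?U \<subseteq> far_side a (P \<union> R)" | "?U \<subseteq> far_side a (Q \<union> R)"
    using connected_subset_far_side[OF U(2) dis(1) z] connected_subset_far_side[OF U(2) dis(2) z] by blast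
  then show ?thesis
  proof cases
    case 1
    have "Q \<subseteq> far_side a (P \<union> R) \<union> (P \<union> R)"
      using closure_mono[OF 1] closure_far_side[OF jordans(1) aPQ] closure_far_side[OF jordans(2)] ref
      by simp
    then show ?thesis using disj by blast
  next
    case 2
    have "P \<subseteq> far_side a (Q \<union> R) \<union> (Q \<union> R)"
      using closure_mono[OF 2] closure_far_side[OF jordans(1) aPQ] closure_far_side[OF jordans(3)] ref
      by simp
    then show ?thesis using disj by blast
  qed
qed simp

text \<open>The two smaller cycles run in the closed far side of \<open>P \<union> Q\<close>, which
  gives the inclusions. If their far sides met, each would be connected and miss the boundary of the
  other. They would then coincide and have equal frontiers, leaving \<open>P\<close> with nothing
  but its ends.\<close>

lemma (in theta) subset_of_middle:
  assumes "R - {s, t} \<subseteq> far_side a (P \<union> Q)"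
  shows "far_side a (P \<union> R) \<subseteq> far_side a (P \<union> Q)" "far_side a (Q \<union> R) \<subseteq> far_side a (P \<union> Q)"
    "far_side a (P \<union> R) \<inter> far_side a (Q \<union> R) = {}"
proof -
  have R0: "R \<subseteq> {s, t} \<union> far_side a (P \<union> Q)" using assms by (simp only: Diff_subset_conv)
  have "{s, t} \<subseteq> P \<union> Q" using arc_between_facts(3,4)[OF arcs(1)] by simp
  then have R: "P \<union> R \<subseteq> (P \<union> Q) \<union> far_side a (P \<union> Q)" "Q \<union> R \<subseteq> (P \<union> Q) \<union> far_side a (P \<union> Q)"
    using R0 by auto
  have aPQ: "a \<notin> P \<union> Q" using ref by blast
  show 1: "far_side a (P \<union> R) \<subseteq> far_side a (P \<union> Q)"
    by (rule far_side_nested[OF jordans(1) aPQ R(1) jordans(2)])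
  show 2: "far_side a (Q \<union> R) \<subseteq> far_side a (P \<union> Q)"
    by (rule far_side_nested[OF jordans(1) aPQ R(2) jordans(3)])
  show "far_side a (P \<union> R) \<inter> far_side a (Q \<union> R) = {}"
  proof (rule ccontr)
    assume ne: "\<not> ?thesis"
    have aPR: "a \<notin> P \<union> R" and aQR: "a \<notin> Q \<union> R" using ref by auto
    note PR = jordan_far_side[OF jordans(2) aPR] and QR = jordan_far_side[OF jordans(3) aQR]
    obtain z where z: "z \<in> far_side a (P \<union> R)" "z \<in> far_side a (Q \<union> R)" using ne by blast
    have "far_side a (P \<union> R) \<inter> (Q \<union> R) = {}"
      using 1 far_side_disjoint[of a "P \<union> Q"] far_side_disjoint[of a "P \<union> R"] by fastforce
    then have "far_side a (P \<union> R) \<subseteq> far_side a (Q \<union> R)"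
      by (rule connected_subset_far_side[OF PR(2) _ z])
    moreover have "far_side a (Q \<union> R) \<inter> (P \<union> R) = {}"
      using 2 far_side_disjoint[of a "P \<union> Q"] far_side_disjoint[of a "Q \<union> R"] by fastforce
    then have "far_side a (Q \<union> R) \<subseteq> far_side a (P \<union> R)"
      by (rule connected_subset_far_side[OF QR(2) _ z(2,1)])
    ultimately have "far_side a (P \<union> R) = far_side a (Q \<union> R)" by (rule equalityI)
    then have "frontier (far_side a (P \<union> R)) = frontier (far_side a (Q \<union> R))" by (rule arg_cong)
    then have "P \<union> R = Q \<union> R" unfolding PR(3) QR(3) .
    then have "P \<subseteq> Q \<union> R" by (metis Un_upper1)
    then have "P \<subseteq> (P \<inter> Q) \<union> (P \<inter> R)" by auto
    also have "\<dots> \<subseteq> {s, t}" using disj(1,2) by (rule Un_least)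
    finally have "P - {s, t} = {}" by (simp only: Diff_eq_empty_iff)
    then show False using arc_between_interior(2)[OF arcs(1)] by simp
  qed
qed

text \<open>Whichever arc is the middle one, the two sides that it bounds with the other arcs are
  disjoint.\<close>

lemma no_common_middle:
  assumes "theta P Q R s t a" and K: "K \<noteq> {}"
    "K \<subseteq> far_side a (P \<union> Q)" "K \<subseteq> far_side a (P \<union> R)" "K \<subseteq> far_side a (Q \<union> R)"
  shows False
proof -
  interpret theta P Q R s t a by fact
  from middle show False
  proof (elim disjE)
    assume "R - {s, t} \<subseteq> far_side a (P \<union> Q)"
    have "far_side a (P \<union> R) \<inter> far_side a (Q \<union> R) = {}" by (rule subset_of_middle(3)) fact
    then show False using K by blast
  next
    assume "Q - {s, t} \<subseteq> far_side a (P \<union> R)"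
    from theta.subset_of_middle(3)[OF swap23 this] have "far_side a (P \<union> Q) \<inter> far_side a (Q \<union> R) = {}"
      by (simp only: Un_commute[of R Q] Un_commute[of Q P] Un_commute[of R P])
    then show False using K by blast
  next
    assume "P - {s, t} \<subseteq> far_side a (Q \<union> R)"
    from theta.subset_of_middle(3)[OF theta.swap23[OF swap12] this]
    have "far_side a (P \<union> Q) \<inter> far_side a (P \<union> R) = {}"
      by (simp only: Un_commute[of R Q] Un_commute[of Q P] Un_commute[of R P])
    then show False using K by blast
  qed
qed

subsection \<open>Plane graphs\<close>

locale undirected_graph =
  fixes V :: "'a set" and E :: "'a rel"
  assumes simple: "simple_graph V E"
begin

lemma E_sym: "(u, v) \<in> E \<Longrightarrow> (v, u) \<in> E"
  using simple unfolding simple_graph_def by (auto dest: symD)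

lemma E_irrefl: "(u, u) \<notin> E"
  using simple unfolding simple_graph_def irrefl_def by auto

lemma E_in_V: "(u, v) \<in> E \<Longrightarrow> u \<in> V" "(u, v) \<in> E \<Longrightarrow> v \<in> V"
  using simple unfolding simple_graph_def by auto

end

locale plane_graph = undirected_graph +
  fixes p :: "'a \<Rightarrow> complex" and c :: "'a set \<Rightarrow> real \<Rightarrow> complex"
  assumes drawing: "planar_drawing V E p c"
begin

definition edges :: "'a set set" where
  "edges = {{u, v} | u v. (u, v) \<in> E}"

definition drawn :: "'a set set \<Rightarrow> complex set" where
  "drawn F = (\<Union>e\<in>F. path_image (c e))"

lemma edgesI: "(u, v) \<in> E \<Longrightarrow> {u, v} \<in> edges"
  unfolding edges_def by blast

lemma drawn_insert: "drawn (insert e F) = drawn {e} \<union> drawn F"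
  by (auto simp: drawn_def)

lemma drawn_Un: "drawn (F \<union> G) = drawn F \<union> drawn G"
  by (auto simp: drawn_def)

lemma drawn_mono: "F \<subseteq> G \<Longrightarrow> drawn F \<subseteq> drawn G"
  by (auto simp: drawn_def)

lemma arc_between_edge:
  assumes "(u, v) \<in> E"
  shows "arc_between (drawn {{u, v}}) (p u) (p v)"
proof -
  have "\<forall>(x, y)\<in>E. arc (c {x, y}) \<and> {pathstart (c {x, y}), pathfinish (c {x, y})} = {p x, p y}"
    using drawing unfolding planar_drawing_def by (elim conjE)
  from bspec[OF this assms] have "arc (c {u, v})"
    and ends: "{pathstart (c {u, v}), pathfinish (c {u, v})} = {p u, p v}" by simp_all
  from ends consider "pathstart (c {u, v}) = p u" "pathfinish (c {u, v}) = p v"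
    | "pathstart (c {u, v}) = p v" "pathfinish (c {u, v}) = p u"
    by (auto simp: doubleton_eq_iff)
  then have "arc_between (path_image (c {u, v})) (p u) (p v)"
  proof cases
    case 1
    then show ?thesis using \<open>arc (c {u, v})\<close> unfolding arc_between_def by blast
  next
    case 2
    then show ?thesis using \<open>arc (c {u, v})\<close>
      by (intro arc_between_sym[of _ "p v"]) (unfold arc_between_def, blast)
  qed
  then show ?thesis by (simp add: drawn_def)
qed

lemma p_inj: "u \<in> V \<Longrightarrow> v \<in> V \<Longrightarrow> p u = p v \<longleftrightarrow> u = v"
  using drawing unfolding planar_drawing_def inj_on_def by blast

lemma p_in_edge:
  assumes "(u, v) \<in> E" "w \<in> V"
  shows "p w \<in> path_image (c {u, v}) \<longleftrightarrow> w \<in> {u, v}"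
proof -
  have "\<forall>(x, y)\<in>E. path_image (c {x, y}) \<inter> p ` V = {p x, p y}"
    using drawing unfolding planar_drawing_def by (elim conjE)
  from bspec[OF this assms(1)] have "path_image (c {u, v}) \<inter> p ` V = {p u, p v}" by simp
  moreover have "p w \<in> p ` V" using assms(2) by blast
  ultimately have "p w \<in> path_image (c {u, v}) \<longleftrightarrow> p w \<in> {p u, p v}" by blast
  then show ?thesis using p_inj assms E_in_V[OF assms(1)] by auto
qed

lemma edge_meet:
  assumes "e \<in> edges" "e' \<in> edges" "e \<noteq> e'"
  shows "path_image (c e) \<inter> path_image (c e') \<subseteq> p ` (e \<inter> e')"
proof -
  obtain x y where e: "(x, y) \<in> E" "e = {x, y}" using assms(1) unfolding edges_def by blast
  obtain u v where e': "(u, v) \<in> E" "e' = {u, v}" using assms(2) unfolding edges_def by blast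
  have "\<forall>(x, y)\<in>E. \<forall>(u, v)\<in>E. {x, y} \<noteq> {u, v} \<longrightarrow>
        path_image (c {x, y}) \<inter> path_image (c {u, v}) \<subseteq> p ` ({x, y} \<inter> {u, v})"
    using drawing unfolding planar_drawing_def by (elim conjE)
  from bspec[OF this e(1)] have "\<forall>(u, v)\<in>E. {x, y} \<noteq> {u, v} \<longrightarrow>
        path_image (c {x, y}) \<inter> path_image (c {u, v}) \<subseteq> p ` ({x, y} \<inter> {u, v})" by simp
  from bspec[OF this e'(1)] show ?thesis using assms(3) unfolding e(2) e'(2) by simp
qed

lemma p_in_drawn:
  assumes "F \<subseteq> edges" "w \<in> V"
  shows "p w \<in> drawn F \<longleftrightarrow> w \<in> \<Union>F"
proof -
  have "p w \<in> path_image (c e) \<longleftrightarrow> w \<in> e" if "e \<in> F" for e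
  proof -
    have "e \<in> edges" using assms(1) that by blast
    then obtain x y where e: "(x, y) \<in> E" "e = {x, y}" unfolding edges_def by blast
    then show ?thesis using p_in_edge[OF e(1) assms(2)] by simp
  qed
  then show ?thesis by (auto simp: drawn_def)
qed

lemma drawn_meet:
  assumes "F \<subseteq> edges" "G \<subseteq> edges" "F \<inter> G = {}"
  shows "drawn F \<inter> drawn G \<subseteq> p ` (\<Union>F \<inter> \<Union>G)"
proof
  fix z assume "z \<in> drawn F \<inter> drawn G"
  then obtain e e' where e: "e \<in> F" "z \<in> path_image (c e)" "e' \<in> G" "z \<in> path_image (c e')"
    unfolding drawn_def by blast
  moreover have "e \<in> edges" "e' \<in> edges" "e \<noteq> e'" using e(1,3) assms by auto
  then have "z \<in> p ` (e \<inter> e')" using edge_meet[of e e'] e(2,4) by blast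
  then show "z \<in> p ` (\<Union>F \<inter> \<Union>G)" using e(1,3) by blast
qed

text \<open>A simple path is recorded by its edge set alone: far sides depend only on the drawn
  point set, and a cycle assembled from different paths stays the same set. The condition on
  \<open>s\<close> keeps the path simple.\<close>

inductive path_edges :: "'a set set \<Rightarrow> 'a \<Rightarrow> 'a \<Rightarrow> bool" where
  single: "(s, t) \<in> E \<Longrightarrow> path_edges {{s, t}} s t"
| step: "(s, u) \<in> E \<Longrightarrow> path_edges F u t \<Longrightarrow> s \<notin> \<Union>F \<Longrightarrow> path_edges (insert {s, u} F) s t"

lemma path_edges_arc:
  assumes "path_edges F s t"
  shows "F \<subseteq> edges \<and> s \<in> \<Union>F \<and> t \<in> \<Union>F \<and> s \<in> V \<and> t \<in> V \<and> arc_between (drawn F) (p s) (p t)"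
  using assms
proof induction
  case (single s t)
  then show ?case using arc_between_edge[OF single] edgesI[OF single] E_in_V[OF single] by simp
next
  case (step s u F t)
  have e: "{s, u} \<in> edges" by (rule edgesI[OF step(1)])
  have "drawn {{s, u}} \<inter> drawn F \<subseteq> p ` (\<Union>{{s, u}} \<inter> \<Union>F)"
    using step by (intro drawn_meet) (use e in auto)
  also have "\<dots> \<subseteq> {p u}" using step(3) by auto
  finally have "arc_between (drawn {{s, u}} \<union> drawn F) (p s) (p t)"
    using step by (intro arc_between_join[OF arc_between_edge]) auto
  then show ?case using step e E_in_V[OF step(1)] by (simp add: drawn_insert[of "{s, u}" F])
qed

lemma path_edges_meet:
  assumes "path_edges F s t" "path_edges G s t" "F \<inter> G = {}" "\<Union>F \<inter> \<Union>G \<subseteq> {s, t}"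
  shows "drawn F \<inter> drawn G \<subseteq> {p s, p t}"
proof -
  have "drawn F \<inter> drawn G \<subseteq> p ` (\<Union>F \<inter> \<Union>G)"
    using path_edges_arc[OF assms(1)] path_edges_arc[OF assms(2)] assms(3) by (intro drawn_meet) auto
  then show ?thesis using assms(4) by auto
qed

lemma jordan_paths:
  assumes "path_edges F s t" "path_edges G s t" "F \<inter> G = {}" "\<Union>F \<inter> \<Union>G \<subseteq> {s, t}"
  shows "jordan (drawn (F \<union> G))"
  unfolding drawn_Un
  using path_edges_arc[OF assms(1)] path_edges_arc[OF assms(2)] path_edges_meet[OF assms]
  by (intro jordan_arcs[of _ "p s" "p t"]) auto

lemma theta_paths:
  assumes "path_edges F s t" "path_edges G s t" "path_edges H s t"
    "F \<inter> G = {}" "\<Union>F \<inter> \<Union>G \<subseteq> {s, t}" "F \<inter> H = {}" "\<Union>F \<inter> \<Union>H \<subseteq> {s, t}"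
    "G \<inter> H = {}" "\<Union>G \<inter> \<Union>H \<subseteq> {s, t}"
    "a \<notin> drawn F" "a \<notin> drawn G" "a \<notin> drawn H"
  shows "theta (drawn F) (drawn G) (drawn H) (p s) (p t) a"
  using path_edges_arc[OF assms(1)] path_edges_arc[OF assms(2)] path_edges_arc[OF assms(3)]
    path_edges_meet[OF assms(1,2,4,5)] path_edges_meet[OF assms(1,3,6,7)] path_edges_meet[OF assms(2,3,8,9)]
    assms(10-)
  by unfold_locales auto

text \<open>As \<open>u\<close> is off \<open>F\<close>, the edge is not in \<open>F\<close>. Hence
  its arc without \<open>p v\<close> is connected and misses the drawing of
  \<open>F\<close>.\<close>

lemma edge_from_side:
  assumes F: "F \<subseteq> edges" and uv: "(u, v) \<in> E" and u: "p u \<in> far_side a (drawn F)"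
  shows "drawn {{u, v}} - {p v} \<subseteq> far_side a (drawn F)"
    "p v \<in> far_side a (drawn F) \<or> v \<in> \<Union>F"
proof -
  note V = E_in_V[OF uv]
  have e: "{u, v} \<in> edges" by (rule edgesI[OF uv])
  have "p u \<notin> drawn F" using u by (simp add: far_side_def)
  then have nu: "u \<notin> \<Union>F" using p_in_drawn[OF F V(1)] by simp
  then have "{{u, v}} \<inter> F = {}" by auto
  then have m: "drawn {{u, v}} \<inter> drawn F \<subseteq> p ` (\<Union>{{u, v}} \<inter> \<Union>F)"
    using F e by (intro drawn_meet) auto
  have m': "p ` (\<Union>{{u, v}} \<inter> \<Union>F) \<subseteq> {p v}" using nu by auto
  have pu: "p u \<in> drawn {{u, v}}" "p u \<noteq> p v" and pv: "p v \<in> drawn {{u, v}}"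
    using arc_between_facts[OF arc_between_edge[OF uv]] by auto
  show "drawn {{u, v}} - {p v} \<subseteq> far_side a (drawn F)"
    by (rule connected_subset_far_side[OF arc_between_open_end[OF arc_between_edge[OF uv]] _ _ u])
      (use m m' pu in auto)
  show "p v \<in> far_side a (drawn F) \<or> v \<in> \<Union>F"
  proof (rule disjCI)
    assume "v \<notin> \<Union>F"
    then have "drawn {{u, v}} \<inter> drawn F = {}" using m nu by auto
    then have "drawn {{u, v}} \<subseteq> far_side a (drawn F)"
      by (rule connected_subset_far_side[OF arc_between_facts(2)[OF arc_between_edge[OF uv]] _ pu(1) u])
    then show "p v \<in> far_side a (drawn F)" using pv by blast
  qed
qed

end

subsection \<open>Vertices of large degree\<close>

text \<open>All that is needed from curvature is the domination inequality \<open>star\<close>, so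
  the planar argument can be carried out without it. Up to the correction
  \<open>1 + card (B \<inter> N)\<close>, the set \<open>insert y B\<close> dominates more than the
  proportion of \<open>B\<close> among the neighbours of \<open>y\<close>. The assumptions are to be
  refuted.\<close>

locale hub = plane_graph +
  fixes x :: 'a
  assumes locally_finite: "v \<in> V \<Longrightarrow> finite (E `` {v})"
    and min_degree: "v \<in> V \<Longrightarrow> 3 \<le> card (E `` {v})"
    and hub_in_V: "x \<in> V"
    and hub_degree: "25 \<le> card (E `` {x})"
    and star: "(x, y) \<in> E \<Longrightarrow> B \<subseteq> E `` {y} - {x} \<Longrightarrow>
      card B * card (E `` {x}) <
      (card (E `` {x} \<inter> (insert y B \<union> E `` insert y B)) + 1 + card (B \<inter> E `` {x})) * card (E `` {y})"
begin

abbreviation "N \<equiv> E `` {x}"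

lemma N_facts: "finite N" "x \<notin> N" "z \<in> N \<Longrightarrow> z \<in> V" "z \<in> N \<Longrightarrow> z \<noteq> x" "z \<in> N \<Longrightarrow> (z, x) \<in> E"
  using locally_finite[OF hub_in_V] E_irrefl E_in_V E_sym by auto

section \<open>Short paths and cycles through the hub\<close>

definition spoke :: "'a \<Rightarrow> 'a set set" where "spoke z = {{x, z}}"
definition via :: "'a \<Rightarrow> 'a \<Rightarrow> 'a set set" where "via z v = {{x, z}, {z, v}}"
definition via2 :: "'a \<Rightarrow> 'a \<Rightarrow> 'a \<Rightarrow> 'a set set" where "via2 z w v = {{x, z}, {z, w}, {w, v}}"

lemma path_spoke: "z \<in> N \<Longrightarrow> path_edges (spoke z) x z"
  unfolding spoke_def by (auto intro: path_edges.single)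

lemma path_via: "z \<in> N \<Longrightarrow> (z, v) \<in> E \<Longrightarrow> v \<noteq> x \<Longrightarrow> path_edges (via z v) x v"
  unfolding via_def using N_facts(4)[of z] by (intro path_edges.intros) auto

lemma path_via2:
  "z \<in> N \<Longrightarrow> (z, w) \<in> E \<Longrightarrow> (w, v) \<in> E \<Longrightarrow> v \<noteq> x \<Longrightarrow> w \<noteq> x \<Longrightarrow> z \<noteq> v \<Longrightarrow> path_edges (via2 z w v) x v"
  unfolding via2_def using N_facts(4)[of z] E_irrefl[of z] by (intro path_edges.intros) auto

lemma Union_paths: "\<Union>(spoke z) = {x, z}" "\<Union>(via z v) = {x, z, v}" "\<Union>(via2 z w v) = {x, z, w, v}"
  unfolding spoke_def via_def via2_def by auto

text \<open>
  A cut is a cycle of length 3 or 4 through the hub, given with its two neighbours \<open>r\<close>, \<open>s\<close> of the hub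
  and the set \<open>W\<close> of its remaining vertices, none of which is a neighbour of the hub.
\<close>

definition cut :: "'a set set \<Rightarrow> 'a \<Rightarrow> 'a \<Rightarrow> 'a set \<Rightarrow> bool" where
  "cut F r s W \<longleftrightarrow> r \<in> N \<and> s \<in> N \<and> r \<noteq> s \<and>
    (W = {} \<and> (r, s) \<in> E \<and> F = spoke r \<union> via s r \<or>
     (\<exists>w. W = {w} \<and> w \<notin> N \<and> w \<noteq> x \<and> (r, w) \<in> E \<and> (s, w) \<in> E \<and> F = via r w \<union> via s w))"

lemma cut_spoke_via: "v \<in> N \<Longrightarrow> z \<in> N \<Longrightarrow> (z, v) \<in> E \<Longrightarrow> cut (spoke v \<union> via z v) v z {}"
  unfolding cut_def using E_irrefl E_sym by auto

lemma cut_via_via: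
  "r \<in> N \<Longrightarrow> s \<in> N \<Longrightarrow> r \<noteq> s \<Longrightarrow> w \<notin> N \<Longrightarrow> w \<noteq> x \<Longrightarrow> (r, w) \<in> E \<Longrightarrow> (s, w) \<in> E \<Longrightarrow> cut (via r w \<union> via s w) r s {w}"
  unfolding cut_def by auto

lemma cut_spoke_via2:
  assumes "v \<in> N" "z \<in> N" "v \<noteq> z" "w \<notin> N" "w \<noteq> x" "(z, w) \<in> E" "(w, v) \<in> E"
  shows "cut (spoke v \<union> via2 z w v) v z {w}"
proof -
  have "spoke v \<union> via2 z w v = via v w \<union> via z w"
    unfolding spoke_def via2_def via_def by (auto simp: insert_commute)
  then show ?thesis using cut_via_via[of v z w] assms E_sym by auto
qed

lemma cut_facts:
  assumes "cut F r s W"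
  shows "F \<subseteq> edges" "\<Union>F = {x, r, s} \<union> W" "jordan (drawn F)" "r \<in> N" "s \<in> N" "r \<noteq> s" "W \<inter> N = {}" "x \<notin> W"
    "spoke r \<subseteq> F" "spoke s \<subseteq> F" "card W \<le> 1" "finite W"
proof -
  have rs: "r \<in> N" "s \<in> N" "r \<noteq> s" using assms unfolding cut_def by auto
  consider (tri) "W = {}" "(r, s) \<in> E" "F = spoke r \<union> via s r"
    | (quad) w where "W = {w}" "w \<notin> N" "w \<noteq> x" "(r, w) \<in> E" "(s, w) \<in> E" "F = via r w \<union> via s w"
    using assms unfolding cut_def by blast
  then have "F \<subseteq> edges \<and> \<Union>F = {x, r, s} \<union> W \<and> jordan (drawn F) \<and> W \<inter> N = {} \<and> x \<notin> W \<and> spoke r \<subseteq> F \<and> spoke s \<subseteq> F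
    \<and> card W \<le> 1 \<and> finite W"
  proof cases
    case tri
    note P = path_spoke[OF rs(1)] path_via[OF rs(2) E_sym[OF tri(2)] N_facts(4)[OF rs(1)]]
    have "jordan (drawn F)" unfolding tri(3)
      by (rule jordan_paths[OF P]) (use rs N_facts(4) in \<open>auto simp: spoke_def via_def doubleton_eq_iff\<close>)
    then show ?thesis
      using tri path_edges_arc[OF P(1)] path_edges_arc[OF P(2)] by (auto simp: Union_paths spoke_def via_def)
  next
    case quad
    note P = path_via[OF rs(1) quad(4,3)] path_via[OF rs(2) quad(5,3)]
    have "jordan (drawn F)" unfolding quad(6)
      by (rule jordan_paths[OF P]) (use rs N_facts(4) quad(2,3) in \<open>auto simp: spoke_def via_def doubleton_eq_iff\<close>)
    then show ?thesis
      using quad path_edges_arc[OF P(1)] path_edges_arc[OF P(2)] by (auto simp: Union_paths spoke_def via_def)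
  qed
  then show "F \<subseteq> edges" "\<Union>F = {x, r, s} \<union> W" "jordan (drawn F)" "r \<in> N" "s \<in> N" "r \<noteq> s" "W \<inter> N = {}" "x \<notin> W"
    "spoke r \<subseteq> F" "spoke s \<subseteq> F" "card W \<le> 1" "finite W"
    using rs by auto
qed

end

text \<open>The reference point is fixed, so that regions can be compared by inclusion. The
  threshold 3 is what the final count contradicts, since it leaves room for two hub neighbours.
  Conversely, having at most two of them in every smaller region keeps the dominated sets small
  enough for \<open>star\<close>.\<close>

locale hub_region = hub +
  fixes a :: complex and F\<^sub>0 :: "'a set set" and r\<^sub>0 s\<^sub>0 :: 'a and W\<^sub>0 :: "'a set"
  assumes cut\<^sub>0: "cut F\<^sub>0 r\<^sub>0 s\<^sub>0 W\<^sub>0" and ref\<^sub>0: "a \<notin> drawn F\<^sub>0"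
    and large\<^sub>0: "3 \<le> card {z \<in> N. p z \<in> far_side a (drawn F\<^sub>0)}"
    and minimal\<^sub>0: "\<And>F r s W. cut F r s W \<Longrightarrow> a \<notin> drawn F \<Longrightarrow> far_side a (drawn F) \<subset> far_side a (drawn F\<^sub>0) \<Longrightarrow>
      card {z \<in> N. p z \<in> far_side a (drawn F)} \<le> 2"
begin

definition side :: "'a set set \<Rightarrow> 'a set" where
  "side F = {v \<in> V. p v \<in> far_side a (drawn F)}"

text \<open>Edge sets drawn in the closed region avoid \<open>a\<close>, and every cut made from
  them has its far side inside the region.\<close>

definition enclosed :: "'a set set \<Rightarrow> bool" where
  "enclosed F \<longleftrightarrow> F \<subseteq> edges \<and> drawn F \<subseteq> far_side a (drawn F\<^sub>0) \<union> drawn F\<^sub>0"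

lemma enclosed_Un: "enclosed F \<Longrightarrow> enclosed G \<Longrightarrow> enclosed (F \<union> G)"
  unfolding enclosed_def by (auto simp: drawn_Un)

lemma N_side: "{z \<in> N. p z \<in> far_side a (drawn F)} = N \<inter> side F"
  using N_facts(3) by (auto simp: side_def)

lemma ref_enclosed: "enclosed F \<Longrightarrow> a \<notin> drawn F"
  using ref\<^sub>0 ref_notin_far_side unfolding enclosed_def by blast

lemma side_notin: "F \<subseteq> edges \<Longrightarrow> v \<in> side F \<Longrightarrow> v \<notin> \<Union>F"
  using p_in_drawn[of F v] far_side_disjoint[of a "drawn F"] unfolding side_def by blast

lemma side_edge: "F \<subseteq> edges \<Longrightarrow> v \<in> side F \<Longrightarrow> (v, u) \<in> E \<Longrightarrow> u \<in> side F \<or> u \<in> \<Union>F"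
  using edge_from_side(2)[of F v u a] E_in_V unfolding side_def by blast

lemma enclosed_edge:
  assumes "v \<in> side F\<^sub>0" "(v, u) \<in> E"
  shows "enclosed {{v, u}}"
proof -
  note F = cut_facts(1)[OF cut\<^sub>0]
  have 1: "drawn {{v, u}} - {p u} \<subseteq> far_side a (drawn F\<^sub>0)"
    and 2: "p u \<in> far_side a (drawn F\<^sub>0) \<or> u \<in> \<Union>F\<^sub>0"
    using edge_from_side[OF F assms(2)] assms(1) unfolding side_def by blast+
  have "p u \<in> far_side a (drawn F\<^sub>0) \<union> drawn F\<^sub>0"
    using 2 p_in_drawn[OF F E_in_V(2)[OF assms(2)]] by blast
  then show ?thesis using 1 edgesI[OF assms(2)] unfolding enclosed_def by blast
qed

lemma enclosed_spoke:
  assumes "z \<in> N" "z \<in> side F\<^sub>0 \<or> z \<in> \<Union>F\<^sub>0"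
  shows "enclosed (spoke z)"
proof (cases "z \<in> side F\<^sub>0")
  case True
  then show ?thesis using enclosed_edge[OF True N_facts(5)[OF assms(1)]] by (simp add: spoke_def insert_commute)
next
  case False
  then have "z \<in> {r\<^sub>0, s\<^sub>0}"
    using assms cut_facts(2,7)[OF cut\<^sub>0] N_facts(2) by auto
  then have "spoke z \<subseteq> F\<^sub>0" using cut_facts(9,10)[OF cut\<^sub>0] by auto
  then show ?thesis using cut_facts(1)[OF cut\<^sub>0] drawn_mono[of "spoke z" "F\<^sub>0"]
    unfolding enclosed_def by auto
qed

lemma nbr_of_side: "v \<in> side F\<^sub>0 \<Longrightarrow> (v, u) \<in> E \<Longrightarrow> u \<in> side F\<^sub>0 \<or> u \<in> \<Union>F\<^sub>0"
  using side_edge[OF cut_facts(1)[OF cut\<^sub>0]] .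

lemma enclosed_via:
  assumes "v \<in> side F\<^sub>0" "z \<in> N" "(z, v) \<in> E"
  shows "enclosed (via z v)"
proof -
  have "enclosed (spoke z)" using enclosed_spoke[OF assms(2)] nbr_of_side[OF assms(1) E_sym[OF assms(3)]] .
  moreover have "enclosed {{z, v}}" using enclosed_edge[OF assms(1) E_sym[OF assms(3)]] by (simp add: insert_commute)
  moreover have "via z v = spoke z \<union> {{z, v}}" by (auto simp: via_def spoke_def)
  ultimately show ?thesis using enclosed_Un by (simp only:)
qed

lemma enclosed_via2:
  assumes "v \<in> side F\<^sub>0" "w \<in> side F\<^sub>0" "z \<in> N" "(z, w) \<in> E" "(w, v) \<in> E"
  shows "enclosed (via2 z w v)"
proof -
  have "enclosed (via z w)" by (rule enclosed_via[OF assms(2-4)])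
  moreover have "enclosed {{w, v}}" using enclosed_edge[OF assms(2,5)] .
  moreover have "via2 z w v = via z w \<union> {{w, v}}" by (auto simp: via_def via2_def)
  ultimately show ?thesis using enclosed_Un by (simp only:)
qed

text \<open>The far side is nested in the region, and properly so because \<open>v\<close> lies on
  the new cycle and hence not in its far side. Minimality then applies.\<close>

lemma subcut:
  assumes "cut F r s W" "enclosed F" "v \<in> side F\<^sub>0" "v \<in> \<Union>F"
  shows "side F \<subseteq> side F\<^sub>0" "card (N \<inter> side F) \<le> 2"
proof -
  have sub: "far_side a (drawn F) \<subseteq> far_side a (drawn F\<^sub>0)"
    using assms(2) unfolding enclosed_def
    by (intro far_side_nested cut_facts(3)[OF cut\<^sub>0] ref\<^sub>0 cut_facts(3)[OF assms(1)]) auto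
  then show "side F \<subseteq> side F\<^sub>0" unfolding side_def by blast
  have "v \<notin> side F" using side_notin[OF cut_facts(1)[OF assms(1)]] assms(4) by blast
  then have "far_side a (drawn F) \<subset> far_side a (drawn F\<^sub>0)"
    using sub assms(3) unfolding side_def by blast
  from minimal\<^sub>0[OF assms(1) ref_enclosed[OF assms(2)] this]
  show "card (N \<inter> side F) \<le> 2" unfolding N_side .
qed

text \<open>With \<open>b = card B\<close>, the assumption \<open>star\<close> gives \<open>25 * b < 6 * (b + 3)\<close>, which forces \<open>B\<close> to be empty.\<close>

lemma small_side:
  assumes F: "cut F r s W" "card (N \<inter> side F) \<le> 2"
    and y: "y \<in> N" "y \<in> side F"
    and B: "B \<subseteq> E `` {y} - {x}" "E `` {y} \<subseteq> {x, r, s} \<union> B"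
      "B \<inter> N \<subseteq> side F" "N \<inter> E `` B \<subseteq> side F \<union> {r, s}"
  shows "E `` {y} = {x, r, s}" "B \<subseteq> {r, s}"
proof -
  note Ff = cut_facts[OF F(1)]
  have yV: "y \<in> V" using y N_facts(3) by blast
  have fin: "finite (E `` {y})" by (rule locally_finite[OF yV])
  then have finB: "finite B" using B(1) finite_subset by blast
  have fi: "finite (N \<inter> side F)" using N_facts(1) by blast
  have "N \<inter> (insert y B \<union> E `` insert y B) \<subseteq> (N \<inter> side F) \<union> {r, s}"
  proof
    fix u assume u: "u \<in> N \<inter> (insert y B \<union> E `` insert y B)"
    then consider "u = y" | "u \<in> B \<inter> N" | "u \<in> N \<inter> E `` B" | "(y, u) \<in> E" "u \<in> N" by blast
    then show "u \<in> (N \<inter> side F) \<union> {r, s}"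
    proof cases
      case 4
      then show ?thesis using side_edge[OF Ff(1) y(2)] Ff(2,7) N_facts(2) by auto
    qed (use y B(3,4) u in auto)
  qed
  then have "card (N \<inter> (insert y B \<union> E `` insert y B)) \<le> card ((N \<inter> side F) \<union> {r, s})"
    using fi by (intro card_mono) auto
  also have "\<dots> \<le> card (N \<inter> side F) + card {r, s}" by (rule card_Un_le)
  also have "\<dots> \<le> 4" using F(2) card_insert_le_m1[of 2 "{s}" r] by (auto simp: card_insert_if)
  finally have R: "card (N \<inter> (insert y B \<union> E `` insert y B)) \<le> 4" .
  have "B \<inter> N \<subseteq> (N \<inter> side F) - {y}" using B(1,3) E_irrefl by blast
  then have "card (B \<inter> N) \<le> card ((N \<inter> side F) - {y})" using fi by (intro card_mono) auto
  also have "\<dots> \<le> 1" using F(2) y fi by (simp add: card_Diff_singleton)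
  finally have T: "card (B \<inter> N) \<le> 1" .
  have "card (E `` {y}) \<le> card ({x, r, s} \<union> B)" using B(2) finB by (intro card_mono) auto
  also have "\<dots> \<le> card {x, r, s} + card B" by (rule card_Un_le)
  also have "card {x, r, s} \<le> 3" by (simp add: card_insert_if)
  finally have d: "card (E `` {y}) \<le> 3 + card B" by simp
  have "card B * 25 \<le> card B * card N" using hub_degree by (rule mult_left_mono) simp
  also have "\<dots> < (card (N \<inter> (insert y B \<union> E `` insert y B)) + 1 + card (B \<inter> N)) * card (E `` {y})"
    using star[of y B] y(1) B(1) by auto
  \<comment> \<open>The factor 6 is 4 + 1 + 1. Already \<open>card B = 1\<close> would mean 25 <
    24.\<close>
  also have "\<dots> \<le> 6 * (3 + card B)" using R T d by (intro mult_mono) auto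
  finally have "B = {}" using finB by (cases "card B") auto
  then show "B \<subseteq> {r, s}" by simp
  have "E `` {y} \<subseteq> {x, r, s}" using B(2) \<open>B = {}\<close> by simp
  moreover have "card {x, r, s} \<le> card (E `` {y})"
    using min_degree[OF yV] \<open>card {x, r, s} \<le> 3\<close> by simp
  ultimately show "E `` {y} = {x, r, s}" by (intro card_seteq) auto
qed

lemma side_N_card: "3 \<le> card (N \<inter> side F\<^sub>0)"
  using large\<^sub>0 unfolding N_side .

lemma theta_via:
  assumes v: "v \<in> side F\<^sub>0" "v \<noteq> x"
    and z: "z \<in> N" "z' \<in> N" "z'' \<in> N" "(z, v) \<in> E" "(z', v) \<in> E" "(z'', v) \<in> E" "z \<noteq> z'" "z \<noteq> z''" "z' \<noteq> z''"
  shows "theta (drawn (via z v)) (drawn (via z' v)) (drawn (via z'' v)) (p x) (p v) a"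
proof (rule theta_paths)
  show "path_edges (via z v) x v" "path_edges (via z' v) x v" "path_edges (via z'' v) x v"
    using z v by (auto intro!: path_via)
  show "a \<notin> drawn (via z v)" "a \<notin> drawn (via z' v)" "a \<notin> drawn (via z'' v)"
    using z v by (auto intro!: ref_enclosed enclosed_via)
qed (use z v N_facts(4) E_irrefl in \<open>auto simp: via_def doubleton_eq_iff\<close>)

section \<open>Vertices of the region not adjacent to the hub\<close>

lemma in_path_interior:
  assumes "path_edges F s t" "z \<in> \<Union>F" "z \<in> V" "z \<noteq> s" "z \<noteq> t"
  shows "p z \<in> drawn F - {p s, p t}"
  using path_edges_arc[OF assms(1)] p_in_drawn[of F z] p_inj assms by auto

text \<open>Among the 4-cycles through the hub and \<open>w\<close>, one with maximal far side has
  all remaining common neighbours inside it. For such an inner vertex \<open>y\<close> the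
  domination inequality excludes any neighbour besides the hub and the two on the cycle, although
  \<open>w\<close> is one.\<close>

lemma outer_nbrs:
  assumes w: "w \<in> side F\<^sub>0" "w \<notin> N" "w \<noteq> x"
  shows "card (N \<inter> E `` {w}) \<le> 2"
proof (rule ccontr)
  assume "\<not> ?thesis"
  then have k: "3 \<le> card (N \<inter> E `` {w})" by simp
  define S where "S = N \<inter> E `` {w}"
  have fS: "finite S" unfolding S_def using N_facts(1) by blast
  define far where "far = (\<lambda>(z, z'). far_side a (drawn (via z w \<union> via z' w)))"
  define Q where "Q = {(z, z'). z \<in> S \<and> z' \<in> S \<and> z \<noteq> z'}"
  have "Q \<subseteq> S \<times> S" unfolding Q_def by auto
  then have "finite Q" using fS finite_subset by blast
  moreover have "Q \<noteq> {}"
  proof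
    assume "Q = {}"
    then have "\<forall>z\<in>S. \<forall>z'\<in>S. z = z'" unfolding Q_def by blast
    then have "card S \<le> 1" using fS card_le_Suc0_iff_eq[OF fS] by simp
    then show False using k unfolding S_def by simp
  qed
  ultimately obtain A where A: "A \<in> far ` Q" "\<forall>B\<in>far ` Q. A \<subseteq> B \<longrightarrow> A = B"
    using finite_has_maximal[of "far ` Q"] by auto
  then obtain z z' where z: "z \<in> S" "z' \<in> S" "z \<noteq> z'" "A = far_side a (drawn (via z w \<union> via z' w))"
    unfolding Q_def far_def by auto
  have S: "u \<in> N" "(u, w) \<in> E" "u \<in> V" "u \<noteq> w" "u \<noteq> x" if "u \<in> S" for u
    using that N_facts(3,4) w unfolding S_def by (auto intro: E_sym)
  let ?F = "via z w \<union> via z' w"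
  have cut: "cut ?F z z' {w}" using z S w by (intro cut_via_via) auto
  have inn: "enclosed ?F" using z S w by (intro enclosed_Un enclosed_via) auto
  have wF: "w \<in> \<Union>?F" by (auto simp: via_def)
  note sub = subcut[OF cut inn w(1) wF]
  have rest: "u \<in> side ?F" if u: "u \<in> S" "u \<noteq> z" "u \<noteq> z'" for u
  proof -
    interpret th: theta "drawn (via z w)" "drawn (via z' w)" "drawn (via u w)" "p x" "p w" a
      using z u S w by (intro theta_via) auto
    have int: "p t \<in> drawn (via t w) - {p x, p w}" if "t \<in> S" for t
      using S[OF that] w by (intro in_path_interior path_via) (auto simp: via_def)
    \<comment> \<open>By maximality the larger side would equal \<open>A\<close>, placing
      \<open>p t\<close> in \<open>A\<close>. But \<open>p t\<close> lies on the boundary of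
      \<open>A\<close>.\<close>
    have max: "\<not> drawn (via t w) - {p x, p w} \<subseteq> far_side a (drawn (via t' w \<union> via u w))"
      if t: "t \<in> S" "t' \<in> S" "t' \<noteq> u" "A \<subseteq> far_side a (drawn (via t' w \<union> via u w))"
        "A = far_side a (drawn (via t w \<union> via t' w))" for t t'
    proof
      assume *: "drawn (via t w) - {p x, p w} \<subseteq> far_side a (drawn (via t' w \<union> via u w))"
      have "(t', u) \<in> Q" unfolding Q_def using t u by auto
      then have "far (t', u) \<in> far ` Q" by (rule imageI)
      then have "A = far_side a (drawn (via t' w \<union> via u w))"
        using A(2) t(4) unfolding far_def by auto
      then have "p t \<in> A" using * int[OF t(1)] by blast
      then show False using t(5) int[OF t(1)] far_side_disjoint[of a "drawn (via t w \<union> via t' w)"]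
        by (auto simp: drawn_Un)
    qed
    from th.middle consider
      (1) "drawn (via u w) - {p x, p w} \<subseteq> far_side a (drawn (via z w) \<union> drawn (via z' w))"
      | (2) "drawn (via z' w) - {p x, p w} \<subseteq> far_side a (drawn (via z w) \<union> drawn (via u w))"
      | (3) "drawn (via z w) - {p x, p w} \<subseteq> far_side a (drawn (via z' w) \<union> drawn (via u w))"
      by blast
    then show ?thesis
    proof cases
      case 1
      then show ?thesis using int[OF u(1)] S[OF u(1)] by (auto simp: side_def drawn_Un)
    next
      case 2
      have "A \<subseteq> far_side a (drawn (via z w \<union> via u w))"
        using theta.subset_of_middle(1)[OF th.swap23 2] unfolding z(4) drawn_Un .
      moreover have "A = far_side a (drawn (via z' w \<union> via z w))" unfolding z(4) by (simp add: Un_commute)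
      ultimately show ?thesis using max[of z' z] z u 2 by (auto simp: drawn_Un)
    next
      case 3
      have "A \<subseteq> far_side a (drawn (via z' w \<union> via u w))"
        using theta.subset_of_middle(1)[OF theta.swap23[OF th.swap12] 3] unfolding z(4) drawn_Un
        by (simp add: Un_commute)
      then show ?thesis using max[of z z'] z u 3 by (auto simp: drawn_Un)
    qed
  qed
  have "\<not> S \<subseteq> {z, z'}"
  proof
    assume "S \<subseteq> {z, z'}"
    then have "card S \<le> card {z, z'}" by (intro card_mono) auto
    also have "\<dots> \<le> 2" by (simp add: card_insert_if)
    finally show False using k unfolding S_def by simp
  qed
  then obtain y where y: "y \<in> S" "y \<noteq> z" "y \<noteq> z'" by blast
  have ys: "y \<in> side ?F" by (rule rest[OF y])
  note cF = cut_facts[OF cut]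
  \<comment> \<open>The vertex \<open>w\<close> on the cycle may be included because, by
    \<open>rest\<close>, its hub neighbours are also inside or equal to \<open>z\<close>,
    \<open>z'\<close>. This inclusion produces the contradiction.\<close>
  let ?B = "E `` {y} \<inter> (side ?F \<union> {w})"
  have "w \<in> ?B" using S[OF y(1)] by blast
  moreover have "?B \<subseteq> {z, z'}"
  proof (rule small_side(2)[OF cut sub(2) S(1)[OF y(1)] ys])
    show "?B \<subseteq> E `` {y} - {x}" using side_notin[OF cF(1), of x] unfolding cF(2) using w(3) by blast
    show "E `` {y} \<subseteq> {x, z, z'} \<union> ?B" using side_edge[OF cF(1) ys] cF(2) by blast
    show "?B \<inter> N \<subseteq> side ?F" using w by blast
    show "N \<inter> E `` ?B \<subseteq> side ?F \<union> {z, z'}"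
    proof
      fix u assume u: "u \<in> N \<inter> E `` ?B"
      then obtain b where b: "b \<in> side ?F \<or> b = w" "(b, u) \<in> E" by blast
      have "u \<in> side ?F \<or> u \<in> {x, z, z'} \<union> {w}" if "b \<in> side ?F"
        using side_edge[OF cF(1) that b(2)] unfolding cF(2) .
      moreover have "u \<in> side ?F \<or> u \<in> {z, z'}" if "b = w"
        using rest[of u] u b(2) that unfolding S_def by blast
      ultimately show "u \<in> side ?F \<union> {z, z'}" using b(1) u w N_facts(2) by auto
    qed
  qed
  ultimately show False using S z by blast
qed

text \<open>Let \<open>B\<close> be all neighbours of \<open>y\<close> strictly inside the cut.
  Planarity keeps what they dominate inside or on the cycle, where minimality allows few hub
  neighbours, so \<open>small_side\<close> makes \<open>B\<close> empty.\<close>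

lemma cut_side_isolated:
  assumes "cut F r s W" "enclosed F" "v \<in> side F\<^sub>0" "v \<in> \<Union>F" "y \<in> N" "y \<in> side F" "E `` {y} \<inter> W = {}"
  shows "E `` {y} = {x, r, s}"
proof (rule small_side(1)[OF assms(1) subcut(2)[OF assms(1-4)] assms(5,6)])
  note F = cut_facts[OF assms(1)]
  have x: "x \<notin> side F" using side_notin[OF F(1), of x] F(2) by blast
  show "E `` {y} \<inter> side F \<subseteq> E `` {y} - {x}" using x by blast
  show "E `` {y} \<subseteq> {x, r, s} \<union> E `` {y} \<inter> side F"
    using side_edge[OF F(1) assms(6)] F(2) assms(7) by blast
  show "E `` {y} \<inter> side F \<inter> N \<subseteq> side F" by blast
  show "N \<inter> E `` (E `` {y} \<inter> side F) \<subseteq> side F \<union> {r, s}"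
  proof
    fix u assume "u \<in> N \<inter> E `` (E `` {y} \<inter> side F)"
    then obtain b where "b \<in> side F" "(b, u) \<in> E" "u \<in> N" by blast
    then show "u \<in> side F \<union> {r, s}"
      using side_edge[OF F(1), of b u] F(2,7) N_facts(2) by auto
  qed
qed

section \<open>Triangles at the hub\<close>

definition fan :: "'a \<Rightarrow> 'a \<Rightarrow> 'a set set" where
  "fan v z = spoke v \<union> via z v"

lemma fan_cut:
  assumes "v \<in> N" "v \<in> side F\<^sub>0" "z \<in> N" "(z, v) \<in> E"
  shows "cut (fan v z) v z {}" "enclosed (fan v z)" "v \<in> \<Union>(fan v z)"
  unfolding fan_def using assms
  by (auto simp: Union_paths intro!: cut_spoke_via enclosed_Un enclosed_spoke enclosed_via)

lemma theta_fan:
  assumes v: "v \<in> N" "v \<in> side F\<^sub>0"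
    and z: "z \<in> N" "(z, v) \<in> E" "z' \<in> N" "(z', v) \<in> E" "z \<noteq> z'"
  shows "theta (drawn (spoke v)) (drawn (via z v)) (drawn (via z' v)) (p x) (p v) a"
proof (rule theta_paths)
  show "path_edges (spoke v) x v" "path_edges (via z v) x v" "path_edges (via z' v) x v"
    using z v N_facts(4) by (auto intro!: path_via path_spoke)
  show "a \<notin> drawn (spoke v)" "a \<notin> drawn (via z v)" "a \<notin> drawn (via z' v)"
    using z v by (auto intro!: ref_enclosed enclosed_via enclosed_spoke)
  have "z \<noteq> v" "z' \<noteq> v" "z \<noteq> x" "z' \<noteq> x" "v \<noteq> x" using z v E_irrefl N_facts(4) by blast+
  then show "spoke v \<inter> via z v = {}" "\<Union>(spoke v) \<inter> \<Union>(via z v) \<subseteq> {x, v}"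
    "spoke v \<inter> via z' v = {}" "\<Union>(spoke v) \<inter> \<Union>(via z' v) \<subseteq> {x, v}"
    "via z v \<inter> via z' v = {}" "\<Union>(via z v) \<inter> \<Union>(via z' v) \<subseteq> {x, v}"
    using z(5) by (auto simp: spoke_def via_def doubleton_eq_iff)
qed

lemma in_via:
  assumes "v \<in> N" "z \<in> N" "(z, v) \<in> E"
  shows "p z \<in> drawn (via z v) - {p x, p v}"
  using assms N_facts(3,4) E_irrefl by (intro in_path_interior path_via) (auto simp: Union_paths)

lemma fan_trichotomy:
  assumes v: "v \<in> N" "v \<in> side F\<^sub>0"
    and z: "z \<in> N" "(z, v) \<in> E" "z' \<in> N" "(z', v) \<in> E" "z \<noteq> z'"
  obtains "z' \<in> side (fan v z)" | "z \<in> side (fan v z')"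
  | "drawn (spoke v) - {p x, p v} \<subseteq> far_side a (drawn (via z v) \<union> drawn (via z' v))"
proof -
  interpret th: theta "drawn (spoke v)" "drawn (via z v)" "drawn (via z' v)" "p x" "p v" a
    by (rule theta_fan[OF assms])
  show ?thesis
    using th.middle in_via[OF v(1) z(1,2)] in_via[OF v(1) z(3,4)] that N_facts(3)[OF z(1)] N_facts(3)[OF z(3)]
    unfolding side_def fan_def drawn_Un by blast
qed

lemma fan_member:
  assumes v: "v \<in> N" "v \<in> side F\<^sub>0"
    and z: "z \<in> N" "(z, v) \<in> E" "z' \<in> N" "(z', v) \<in> E" "z' \<in> side (fan v z)"
  shows "drawn (via z' v) - {p x, p v} \<subseteq> far_side a (drawn (fan v z))" "side (fan v z') \<subseteq> side (fan v z)"
proof -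
  have ne: "z \<noteq> z'"
    using side_notin[OF cut_facts(1)[OF fan_cut(1)[OF v z(1,2)]], of z'] z(5) by (auto simp: fan_def Union_paths)
  interpret th: theta "drawn (spoke v)" "drawn (via z v)" "drawn (via z' v)" "p x" "p v" a
    by (rule theta_fan[OF v z(1-4) ne])
  have "p z' \<in> drawn (via z' v)" using in_via[OF v(1) z(3,4)] by blast
  then show 1: "drawn (via z' v) - {p x, p v} \<subseteq> far_side a (drawn (fan v z))"
    using th.interior_dichotomy z(5) unfolding fan_def drawn_Un side_def by blast
  then show "side (fan v z') \<subseteq> side (fan v z)"
    using th.subset_of_middle(1) unfolding fan_def drawn_Un side_def by blast
qed

lemma spoke_interior: "v \<in> N \<Longrightarrow> drawn (spoke v) - {p x, p v} \<noteq> {}"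
  using arc_between_interior(2) path_edges_arc[OF path_spoke] by blast

text \<open>When neither triangle contains the other apex, the spoke of \<open>v\<close> is the
  middle arc between the two paths. It cannot lie between each two of three paths.\<close>

lemma fan_antichain:
  assumes v: "v \<in> N" "v \<in> side F\<^sub>0"
    and T: "T \<subseteq> N \<inter> E `` {v}" "\<And>z z'. z \<in> T \<Longrightarrow> z' \<in> T \<Longrightarrow> z \<notin> side (fan v z')"
  shows "card T \<le> 2"
proof (rule ccontr)
  assume "\<not> card T \<le> 2"
  then have "3 \<le> card T" by simp
  then obtain T' where "T' \<subseteq> T" "card T' = 3" by (rule obtain_subset_with_card_n)
  then obtain z1 z2 z3 where z: "z1 \<in> T" "z2 \<in> T" "z3 \<in> T" "z1 \<noteq> z2" "z1 \<noteq> z3" "z2 \<noteq> z3"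
    by (auto simp: card_3_iff)
  have C: "z \<in> N" "(z, v) \<in> E" if "z \<in> T" for z using T(1) that E_sym by auto
  have opp: "drawn (spoke v) - {p x, p v} \<subseteq> far_side a (drawn (via z v) \<union> drawn (via z' v))"
    if "z \<in> T" "z' \<in> T" "z \<noteq> z'" for z z'
    by (rule fan_trichotomy[OF v C[OF that(1)] C[OF that(2)] that(3)]) (use T(2) that in simp_all)
  have "theta (drawn (via z1 v)) (drawn (via z2 v)) (drawn (via z3 v)) (p x) (p v) a"
    using z C v N_facts(4) by (intro theta_via) auto
  from no_common_middle[OF this spoke_interior[OF v(1)] opp opp opp] z show False by blast
qed

lemma fan_nbrs:
  assumes v: "v \<in> N" "v \<in> side F\<^sub>0" and z: "z \<in> N" "(z, v) \<in> E" and y: "y \<in> N" "y \<in> side (fan v z)"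
  shows "E `` {y} = {x, v, z}"
  using cut_side_isolated[OF fan_cut(1,2)[OF v z] v(2) fan_cut(3)[OF v z] y] by simp

text \<open>A hub neighbour inside a triangle is adjacent to exactly its three corners. Of two such
  vertices, one inside the other's triangle would have the wrong third corner. Otherwise the spoke
  of \<open>v\<close> would lie between their paths, hence strictly inside the triangle that it
  bounds.\<close>

lemma fan_unique:
  assumes v: "v \<in> N" "v \<in> side F\<^sub>0"
    and z: "z \<in> N \<inter> E `` {v}" "z1 \<in> N \<inter> E `` {v}" "z2 \<in> N \<inter> E `` {v}"
    and m: "z1 \<in> side (fan v z)" "z2 \<in> side (fan v z)"
  shows "z1 = z2"
proof (rule ccontr)
  assume ne: "z1 \<noteq> z2"
  have e: "u \<in> N" "(u, v) \<in> E" if "u \<in> N \<inter> E `` {v}" for u using that E_sym by auto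
  note e0 = e[OF z(1)] and e1 = e[OF z(2)] and e2 = e[OF z(3)]
  have ze: "z \<notin> side (fan v z)"
    using side_notin[OF cut_facts(1)[OF fan_cut(1)[OF v e0]], of z] by (auto simp: fan_def Union_paths)
  have nv: "z1 \<noteq> v" "z2 \<noteq> v" using e1 e2 E_irrefl by auto
  show False
  proof (rule fan_trichotomy[OF v e1 e2 ne])
    assume "z2 \<in> side (fan v z1)"
    then have "{x, v, z1} = {x, v, z}" using fan_nbrs[OF v e1 e2(1)] fan_nbrs[OF v e0 e2(1) m(2)] by simp
    then have "z1 = z" using nv N_facts(4)[OF e1(1)] by auto
    then show False using m ze by simp
  next
    assume "z1 \<in> side (fan v z2)"
    then have "{x, v, z2} = {x, v, z}" using fan_nbrs[OF v e2 e1(1)] fan_nbrs[OF v e0 e1(1) m(1)] by simp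
    then have "z2 = z" using nv N_facts(4)[OF e2(1)] by auto
    then show False using m ze by simp
  next
    assume opp: "drawn (spoke v) - {p x, p v} \<subseteq> far_side a (drawn (via z1 v) \<union> drawn (via z2 v))"
    note c = cut_facts[OF fan_cut(1)[OF v e0]]
    have "p x \<in> drawn (fan v z)" "p v \<in> drawn (fan v z)"
      using p_in_drawn[OF c(1)] c(2) hub_in_V N_facts(3)[OF v(1)] by auto
    then have sub: "drawn (via z1 v) \<union> drawn (via z2 v) \<subseteq> drawn (fan v z) \<union> far_side a (drawn (fan v z))"
      using fan_member(1)[OF v e0 e1 m(1)] fan_member(1)[OF v e0 e2 m(2)] by blast
    have "jordan (drawn (via z1 v) \<union> drawn (via z2 v))"
      by (rule theta.jordans(3)[OF theta_fan[OF v e1 e2 ne]])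
    then have "far_side a (drawn (via z1 v) \<union> drawn (via z2 v)) \<subseteq> far_side a (drawn (fan v z))"
      by (intro far_side_nested[OF c(3) _ sub] ref_enclosed[OF fan_cut(2)[OF v e0]])
    moreover have "drawn (spoke v) \<subseteq> drawn (fan v z)" by (auto simp: fan_def drawn_Un)
    ultimately show False
      using opp spoke_interior[OF v(1)] far_side_disjoint[of a "drawn (fan v z)"] by blast
  qed
qed

text \<open>At most two of these neighbours lie in no triangle of another, by the antichain bound.
  Each remaining one lies in the triangle of such an outermost one, and no triangle holds two. The
  bound 4 is provisional and serves to prove \<open>fan_empty\<close>, which improves it to
  2.\<close>

lemma inner_nbrs_weak:
  assumes v: "v \<in> N" "v \<in> side F\<^sub>0"
  shows "card (N \<inter> E `` {v}) \<le> 4"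
proof -
  define C where "C = N \<inter> E `` {v}"
  have C: "z \<in> N" "(z, v) \<in> E" if "z \<in> C" for z using that E_sym by (auto simp: C_def)
  have fC: "finite C" unfolding C_def using N_facts(1) by blast
  have self: "z \<notin> side (fan v z)" if "z \<in> C" for z
    using side_notin[OF cut_facts(1)[OF fan_cut(1)[OF v C[OF that]]], of z] by (auto simp: fan_def Union_paths)
  define T where "T = {z \<in> C. \<forall>z'\<in>C. z \<notin> side (fan v z')}"
  have T: "card T \<le> 2" by (rule fan_antichain[OF v]) (auto simp: T_def C_def)
  define g where "g = (\<lambda>u. SOME z. z \<in> C \<and> u \<in> side (fan v z))"
  have g: "g u \<in> C \<and> u \<in> side (fan v (g u))" if "u \<in> C - T" for u
    unfolding g_def by (rule someI_ex) (use that in \<open>auto simp: T_def\<close>)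
  \<comment> \<open>Were \<open>g u\<close> itself inside a triangle, its neighbours would be the
    corners of that triangle. As \<open>u\<close> is a neighbour, \<open>u\<close> would be the
    apex, so \<open>u\<close> and \<open>g u\<close> would each lie inside the other's
    triangle.\<close>
  have gT: "g u \<in> T" if u: "u \<in> C - T" for u
  proof (rule ccontr)
    assume "g u \<notin> T"
    then obtain z2 where z2: "z2 \<in> C" "g u \<in> side (fan v z2)" using g[OF u] unfolding T_def by blast
    have uC: "u \<in> C" using u by blast
    note e = C[OF uC] C[OF conjunct1[OF g[OF u]]] C[OF z2(1)]
    have 1: "E `` {u} = {x, v, g u}" using fan_nbrs[OF v e(3,4) e(1)] g[OF u] by blast
    have 2: "E `` {g u} = {x, v, z2}" using fan_nbrs[OF v e(5,6) e(3) z2(2)] .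
    have "(u, g u) \<in> E" using 1 by blast
    then have "u \<in> {x, v, z2}" using 2 E_sym by blast
    then have "u = z2" using N_facts(4)[OF e(1)] e(2) E_irrefl by auto
    then have "g u \<in> side (fan v u)" using z2 by simp
    then have "side (fan v (g u)) \<subseteq> side (fan v u)" using fan_member(2)[OF v e(1,2) e(3,4)] by blast
    then show False using g[OF u] self[OF uC] by blast
  qed
  have "inj_on g (C - T)"
  proof (rule inj_onI)
    fix u u' assume u: "u \<in> C - T" "u' \<in> C - T" "g u = g u'"
    show "u = u'"
      by (rule fan_unique[OF v, of "g u"]) (use u g[OF u(1)] g[OF u(2)] in \<open>auto simp: C_def\<close>)
  qed
  then have "card (C - T) \<le> card T"
    using gT fC by (intro card_inj_on_le[of g]) (auto simp: T_def)
  moreover have "T \<subseteq> C" by (auto simp: T_def)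
  then have "card C = card T + card (C - T)"
    using card_mono[OF fC \<open>T \<subseteq> C\<close>] card_Diff_subset[OF finite_subset[OF \<open>T \<subseteq> C\<close> fC] \<open>T \<subseteq> C\<close>] by simp
  ultimately show ?thesis using T unfolding C_def by linarith
qed

text \<open>A hub neighbour \<open>y\<close> inside has degree 3, so \<open>B = {v}\<close> is
  already a third of its neighbourhood. But \<open>y\<close> and \<open>v\<close> dominate at most
  five hub neighbours, and the inequality gives 25 < 7 * 3.\<close>

lemma fan_empty:
  assumes v: "v \<in> N" "v \<in> side F\<^sub>0" and z: "z \<in> N" "(z, v) \<in> E"
  shows "N \<inter> side (fan v z) = {}"
proof (rule ccontr)
  assume "\<not> ?thesis"
  then obtain y where y: "y \<in> N" "y \<in> side (fan v z)" by blast
  have nb: "E `` {y} = {x, v, z}" by (rule fan_nbrs[OF v z y])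
  have yv: "(v, y) \<in> E" using nb E_sym by blast
  have "N \<inter> (insert y {v} \<union> E `` insert y {v}) = N \<inter> ({y, v} \<union> E `` {y} \<union> E `` {v})" by auto
  also have "\<dots> \<subseteq> insert v (N \<inter> E `` {v})"
    unfolding nb using yv y(1) z E_sym[OF z(2)] N_facts(2) by auto
  finally have "N \<inter> (insert y {v} \<union> E `` insert y {v}) \<subseteq> insert v (N \<inter> E `` {v})" .
  then have "card (N \<inter> (insert y {v} \<union> E `` insert y {v})) \<le> card (insert v (N \<inter> E `` {v}))"
    using N_facts(1) by (intro card_mono) auto
  also have "\<dots> \<le> Suc (card (N \<inter> E `` {v}))" by (simp add: card_insert_le_m1 card_insert_if N_facts(1))
  also have "\<dots> \<le> 5" using inner_nbrs_weak[OF v] by simp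
  finally have R: "card (N \<inter> (insert y {v} \<union> E `` insert y {v})) \<le> 5" .
  have "card (E `` {y}) \<le> 3" unfolding nb by (simp add: card_insert_if)
  moreover have "card ({v} \<inter> N) \<le> 1" using card_mono[of "{v}" "{v} \<inter> N"] by simp
  moreover have "card {v} * card N < (card (N \<inter> (insert y {v} \<union> E `` insert y {v})) + 1 + card ({v} \<inter> N)) * card (E `` {y})"
    using star[of y "{v}"] y(1) nb v(1) N_facts(4)[OF v(1)] by auto
  moreover have "(card (N \<inter> (insert y {v} \<union> E `` insert y {v})) + 1 + card ({v} \<inter> N)) * card (E `` {y}) \<le> (5 + 1 + 1) * 3"
    using R calculation(1,2) by (intro mult_mono add_mono) auto
  ultimately show False using hub_degree by simp
qed

text \<open>With all triangles empty, the neighbours in question form an antichain.\<close>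

lemma inner_nbrs:
  assumes v: "v \<in> N" "v \<in> side F\<^sub>0"
  shows "card (N \<inter> E `` {v}) \<le> 2"
  by (rule fan_antichain[OF v]) (use fan_empty[OF v] E_sym in blast)+

text \<open>The ends \<open>z\<close> of the arms of \<open>y\<close> are the hub neighbours that
  \<open>y\<close> reaches directly or through a vertex of the region not adjacent to the hub.
  Bounding their number bounds most of the dominated set in \<open>side_nbrs\<close>.\<close>

definition arm :: "'a \<Rightarrow> 'a \<Rightarrow> 'a set set \<Rightarrow> bool" where
  "arm y z F \<longleftrightarrow> z \<in> N \<and> z \<noteq> y \<and>
    ((z, y) \<in> E \<and> F = via z y \<or>
     (\<exists>w\<in>side F\<^sub>0. w \<notin> N \<and> w \<noteq> x \<and> (z, w) \<in> E \<and> (w, y) \<in> E \<and> F = via2 z w y))"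

lemma arm_path:
  assumes "y \<in> N" "arm y z F"
  shows "path_edges F x y" "z \<in> \<Union>F" "z \<in> N" "z \<noteq> y"
proof -
  have z: "z \<in> N" "z \<noteq> y" using assms(2) unfolding arm_def by auto
  consider (1) "(z, y) \<in> E" "F = via z y"
    | (2) w where "w \<noteq> x" "(z, w) \<in> E" "(w, y) \<in> E" "F = via2 z w y"
    using assms(2) unfolding arm_def by blast
  then have "path_edges F x y \<and> z \<in> \<Union>F"
  proof cases
    case 1
    then show ?thesis using path_via[OF z(1) 1(1) N_facts(4)[OF assms(1)]] by (simp add: Union_paths)
  next
    case 2
    then show ?thesis using path_via2[OF z(1) 2(2,3) N_facts(4)[OF assms(1)] 2(1) z(2)] by (simp add: Union_paths)
  qed
  then show "path_edges F x y" "z \<in> \<Union>F" "z \<in> N" "z \<noteq> y" using z by blast+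
qed

lemma outer_nbrs_eq:
  assumes "w \<in> side F\<^sub>0" "w \<notin> N" "w \<noteq> x" "(z, w) \<in> E" "(w, y) \<in> E" "z \<in> N" "y \<in> N" "z \<noteq> y"
  shows "N \<inter> E `` {w} = {y, z}"
proof -
  have "{y, z} \<subseteq> N \<inter> E `` {w}" using assms E_sym by auto
  moreover have "card (N \<inter> E `` {w}) \<le> card {y, z}" using outer_nbrs[OF assms(1-3)] assms(8) by simp
  moreover have "finite (N \<inter> E `` {w})" using N_facts(1) by blast
  ultimately show ?thesis using card_seteq by metis
qed

text \<open>For a short arm the last claim is \<open>fan_empty\<close>. For a long one,
  \<open>w\<close> has no hub neighbours except \<open>y\<close> and \<open>z\<close>, so a hub
  neighbour inside the 4-cycle is adjacent only to \<open>x\<close>, \<open>y\<close>,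
  \<open>z\<close>. Testing it with \<open>B = {y}\<close> gives 25 < 6 * 3.\<close>

lemma arm_spoke:
  assumes y: "y \<in> N" "y \<in> side F\<^sub>0" and F: "arm y z F"
  shows "enclosed F" "spoke y \<inter> F = {}" "\<Union>(spoke y) \<inter> \<Union>F \<subseteq> {x, y}" "N \<inter> side (spoke y \<union> F) = {}"
proof -
  have z: "z \<in> N" "z \<noteq> y" and ne: "z \<noteq> x" "y \<noteq> x" using F y N_facts(4) unfolding arm_def by auto
  consider (1) "(z, y) \<in> E" "F = via z y"
    | (2) w where "w \<in> side F\<^sub>0" "w \<notin> N" "w \<noteq> x" "(z, w) \<in> E" "(w, y) \<in> E" "F = via2 z w y"
    using F unfolding arm_def by blast
  then have "enclosed F \<and> spoke y \<inter> F = {} \<and> \<Union>(spoke y) \<inter> \<Union>F \<subseteq> {x, y} \<and> N \<inter> side (spoke y \<union> F) = {}"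
  proof cases
    case 1
    then show ?thesis
      using enclosed_via[OF y(2) z(1) 1(1)] fan_empty[OF y z(1) 1(1)] z(2) ne
      unfolding fan_def 1(2) by (auto simp: spoke_def via_def doubleton_eq_iff)
  next
    case 2
    have wy: "w \<noteq> y" "w \<noteq> z" using 2 z y by auto
    note Nw = outer_nbrs_eq[OF 2(1-5) z(1) y(1) z(2)]
    have enc: "enclosed F" unfolding 2(6) by (rule enclosed_via2[OF y(2) 2(1) z(1) 2(4,5)])
    have cut: "cut (spoke y \<union> F) y z {w}" unfolding 2(6) using 2 y z by (intro cut_spoke_via2) auto
    have enc': "enclosed (spoke y \<union> F)" using enc enclosed_spoke[OF y(1)] y(2) by (intro enclosed_Un) auto
    have wF: "w \<in> \<Union>(spoke y \<union> F)" unfolding 2(6) by (auto simp: via2_def)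
    have "u \<notin> side (spoke y \<union> F)" if u: "u \<in> N" for u
    proof
      assume us: "u \<in> side (spoke y \<union> F)"
      have "u \<notin> {y, z}" using side_notin[OF cut_facts(1)[OF cut] us] cut_facts(2)[OF cut] by auto
      then have "(w, u) \<notin> E" using Nw u by auto
      then have "E `` {u} \<inter> {w} = {}" using E_sym by auto
      from cut_side_isolated[OF cut enc' 2(1) wF u us this] have nb: "E `` {u} = {x, y, z}" .
      have yu: "(y, u) \<in> E" using nb E_sym by blast
      have fC: "finite (N \<inter> E `` {y})" using N_facts(1) by blast
      have "N \<inter> (insert u {y} \<union> E `` insert u {y}) = N \<inter> ({u, y} \<union> E `` {u} \<union> E `` {y})" by auto
      also have "\<dots> \<subseteq> {y, z} \<union> (N \<inter> E `` {y})" unfolding nb using yu u N_facts(2) by auto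
      finally have "card (N \<inter> (insert u {y} \<union> E `` insert u {y})) \<le> card ({y, z} \<union> (N \<inter> E `` {y}))"
        using fC by (intro card_mono) auto
      also have "\<dots> \<le> card {y, z} + card (N \<inter> E `` {y})" by (rule card_Un_le)
      also have "\<dots> \<le> 4" using inner_nbrs[OF y] z(2) by simp
      finally have R: "card (N \<inter> (insert u {y} \<union> E `` insert u {y})) \<le> 4" .
      have d: "card (E `` {u}) \<le> 3" unfolding nb by (simp add: card_insert_if)
      have t: "card ({y} \<inter> N) \<le> 1" using card_mono[of "{y}" "{y} \<inter> N"] by simp
      have "card {y} * card N < (card (N \<inter> (insert u {y} \<union> E `` insert u {y})) + 1 + card ({y} \<inter> N)) * card (E `` {u})"
        using star[of u "{y}"] u nb ne by auto
      moreover have "(card (N \<inter> (insert u {y} \<union> E `` insert u {y})) + 1 + card ({y} \<inter> N)) * card (E `` {u}) \<le> (4 + 1 + 1) * 3"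
        using R d t by (intro mult_mono add_mono) auto
      ultimately show False using hub_degree by simp
    qed
    then show ?thesis using enc wy z(2) ne 2(3,6) by (auto simp: spoke_def via2_def doubleton_eq_iff)
  qed
  then show "enclosed F" "spoke y \<inter> F = {}" "\<Union>(spoke y) \<inter> \<Union>F \<subseteq> {x, y}" "N \<inter> side (spoke y \<union> F) = {}"
    by blast+
qed

text \<open>A middle vertex \<open>w\<close> has only two hub neighbours, \<open>y\<close> and the
  end of its arm, so it cannot serve two arms.\<close>

lemma arms_disjoint:
  assumes y: "y \<in> N" "y \<in> side F\<^sub>0" and F: "arm y z F" and G: "arm y z' G" and ne: "z \<noteq> z'"
  shows "F \<inter> G = {}" "\<Union>F \<inter> \<Union>G \<subseteq> {x, y}"
proof -
  have z: "z \<in> N" "z \<noteq> y" "z' \<in> N" "z' \<noteq> y" using F G unfolding arm_def by auto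
  have nx: "z \<noteq> x" "z' \<noteq> x" "y \<noteq> x" using z y N_facts(4) by auto
  have W: "w \<noteq> w'" if "w \<in> side F\<^sub>0" "w \<notin> N" "w \<noteq> x" "(z, w) \<in> E" "(w, y) \<in> E" "(z', w') \<in> E" for w w'
    using outer_nbrs_eq[OF that(1-5) z(1) y(1) z(2)] E_sym[OF that(6)] z ne by auto
  have FG: "F = via z y \<or> (\<exists>w. w \<in> side F\<^sub>0 \<and> w \<notin> N \<and> w \<noteq> x \<and> (z, w) \<in> E \<and> (w, y) \<in> E \<and> F = via2 z w y)"
    "G = via z' y \<or> (\<exists>w. w \<in> side F\<^sub>0 \<and> w \<notin> N \<and> w \<noteq> x \<and> (z', w) \<in> E \<and> (w, y) \<in> E \<and> G = via2 z' w y)"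
    using F G unfolding arm_def by blast+
  have "F \<inter> G = {} \<and> \<Union>F \<inter> \<Union>G \<subseteq> {x, y}"
  proof (rule disjE[OF FG(1)]; rule disjE[OF FG(2)])
    assume "F = via z y" "G = via z' y"
    then show ?thesis using z nx ne by (auto simp: via_def doubleton_eq_iff)
  next
    assume *: "F = via z y" "\<exists>w. w \<in> side F\<^sub>0 \<and> w \<notin> N \<and> w \<noteq> x \<and> (z', w) \<in> E \<and> (w, y) \<in> E \<and> G = via2 z' w y"
    then obtain w where "w \<notin> N" "w \<noteq> x" "G = via2 z' w y" by blast
    then show ?thesis using * z nx ne y by (auto simp: via_def via2_def doubleton_eq_iff)
  next
    assume *: "G = via z' y" "\<exists>w. w \<in> side F\<^sub>0 \<and> w \<notin> N \<and> w \<noteq> x \<and> (z, w) \<in> E \<and> (w, y) \<in> E \<and> F = via2 z w y"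
    then obtain w where "w \<notin> N" "w \<noteq> x" "F = via2 z w y" by blast
    then show ?thesis using * z nx ne y by (auto simp: via_def via2_def doubleton_eq_iff)
  next
    assume *: "\<exists>w. w \<in> side F\<^sub>0 \<and> w \<notin> N \<and> w \<noteq> x \<and> (z, w) \<in> E \<and> (w, y) \<in> E \<and> F = via2 z w y"
      "\<exists>w. w \<in> side F\<^sub>0 \<and> w \<notin> N \<and> w \<noteq> x \<and> (z', w) \<in> E \<and> (w, y) \<in> E \<and> G = via2 z' w y"
    then obtain w w' where w: "w \<in> side F\<^sub>0" "w \<notin> N" "w \<noteq> x" "(z, w) \<in> E" "(w, y) \<in> E" "F = via2 z w y"
      "w' \<notin> N" "w' \<noteq> x" "(z', w') \<in> E" "G = via2 z' w' y" by blast
    then have "w \<noteq> w'" using W by blast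
    then show ?thesis using w z nx ne y by (auto simp: via2_def doubleton_eq_iff)
  qed
  then show "F \<inter> G = {}" "\<Union>F \<inter> \<Union>G \<subseteq> {x, y}" by blast+
qed

text \<open>
  The spoke of \<open>y\<close> lies between any two of its arms, since no arm encloses a neighbour of the hub
  together with the spoke; but a spoke cannot lie between each two of three arms.
\<close>

lemma few_arms:
  assumes y: "y \<in> N" "y \<in> side F\<^sub>0"
  shows "card {z. \<exists>F. arm y z F} \<le> 2"
proof (rule ccontr)
  assume "\<not> ?thesis"
  then have "3 \<le> card {z. \<exists>F. arm y z F}" by simp
  then obtain T' where "T' \<subseteq> {z. \<exists>F. arm y z F}" "card T' = 3" by (rule obtain_subset_with_card_n)
  then obtain z1 z2 z3 F1 F2 F3 where F: "arm y z1 F1" "arm y z2 F2" "arm y z3 F3"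
    and z: "z1 \<noteq> z2" "z1 \<noteq> z3" "z2 \<noteq> z3"
    by (auto simp: card_3_iff)
  have ref: "a \<notin> drawn F" if "arm y z F" for z F
    using ref_enclosed arm_spoke(1)[OF y that] by blast
  have refs: "a \<notin> drawn (spoke y)" using ref_enclosed enclosed_spoke[OF y(1)] y(2) by blast
  have opp: "drawn (spoke y) - {p x, p y} \<subseteq> far_side a (drawn F \<union> drawn G)"
    if FG: "arm y z F" "arm y z' G" "z \<noteq> z'" for z z' F G
  proof -
    note fF = arm_spoke[OF y FG(1)] and fG = arm_spoke[OF y FG(2)]
    note pF = arm_path[OF y(1) FG(1)] and pG = arm_path[OF y(1) FG(2)]
    interpret th: theta "drawn (spoke y)" "drawn F" "drawn G" "p x" "p y" a
      using refs ref[OF FG(1)] ref[OF FG(2)]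
      by (intro theta_paths path_spoke y(1) pF(1) pG(1) fF(2,3) fG(2,3) arms_disjoint[OF y FG])
    have pz: "p z \<in> drawn F - {p x, p y}"
      using pF N_facts(3,4) by (intro in_path_interior) auto
    have pz': "p z' \<in> drawn G - {p x, p y}"
      using pG N_facts(3,4) by (intro in_path_interior) auto
    have "p z \<notin> far_side a (drawn (spoke y) \<union> drawn G)" "p z' \<notin> far_side a (drawn (spoke y) \<union> drawn F)"
      using fF(4) fG(4) pF(3) pG(3) N_facts(3) unfolding side_def drawn_Un by blast+
    then show ?thesis using th.middle pz pz' by blast
  qed
  note d = arms_disjoint[OF y F(1,2) z(1)] arms_disjoint[OF y F(1,3) z(2)] arms_disjoint[OF y F(2,3) z(3)]
  have "theta (drawn F1) (drawn F2) (drawn F3) (p x) (p y) a"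
    by (rule theta_paths[OF arm_path(1)[OF y(1) F(1)] arm_path(1)[OF y(1) F(2)] arm_path(1)[OF y(1) F(3)] d
          ref[OF F(1)] ref[OF F(2)] ref[OF F(3)]])
  from no_common_middle[OF this spoke_interior[OF y(1)] opp[OF F(1,2) z(1)] opp[OF F(1,3) z(2)] opp[OF F(2,3) z(3)]]
  show False .
qed

text \<open>The domination inequality is applied to all neighbours \<open>B\<close> of
  \<open>y\<close> strictly inside the region. Arms and \<open>inner_nbrs\<close> bound the set that
  they dominate, and this forces \<open>B\<close> to be empty.\<close>

lemma side_nbrs:
  assumes y: "y \<in> N" "y \<in> side F\<^sub>0"
  shows "E `` {y} \<subseteq> {x, r\<^sub>0, s\<^sub>0} \<union> W\<^sub>0"
proof -
  note F = cut_facts[OF cut\<^sub>0]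
  have yV: "y \<in> V" by (rule N_facts(3)[OF y(1)])
  have fin: "finite (E `` {y})" by (rule locally_finite[OF yV])
  define Z where "Z = {z. \<exists>F. arm y z F}"
  have Z: "card Z \<le> 2" unfolding Z_def by (rule few_arms[OF y])
  have ZN: "Z \<subseteq> N" unfolding Z_def arm_def by auto
  have fZ: "finite Z" using ZN N_facts(1) by (rule finite_subset)
  define B where "B = E `` {y} \<inter> side F\<^sub>0"
  have fB: "finite B" using fin unfolding B_def by blast
  have xn: "x \<notin> side F\<^sub>0" using side_notin[OF F(1), of x] F(2) by blast
  have direct: "z \<in> Z" if "z \<in> N" "(y, z) \<in> E" for z
    using that E_sym[OF that(2)] E_irrefl unfolding Z_def arm_def by auto
  have BZ: "B \<inter> N \<subseteq> Z" using direct unfolding B_def by auto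
  \<comment> \<open>Each \<open>u\<close> in \<open>B \<inter> N\<close> has at most two hub
    neighbours, one of which is \<open>y\<close>, so it adds at most one element to
    \<open>U\<close>.\<close>
  define U where "U = (\<Union>u\<in>B \<inter> N. N \<inter> E `` {u} - {y})"
  have "N \<inter> (insert y B \<union> E `` insert y B) \<subseteq> insert y (Z \<union> U)"
  proof
    fix z assume z: "z \<in> N \<inter> (insert y B \<union> E `` insert y B)"
    then consider "z = y" | "z \<in> B" | "(y, z) \<in> E" | u where "u \<in> B" "(u, z) \<in> E" "z \<noteq> y" by blast
    then show "z \<in> insert y (Z \<union> U)"
    proof cases
      case 4
      show ?thesis
      proof (cases "u \<in> N")
        case True
        then show ?thesis using 4 z unfolding U_def by blast
      next
        case False
        then have "z \<in> Z" using 4 z E_sym[OF 4(2)] xn E_sym[of y u]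
          unfolding Z_def arm_def B_def by auto
        then show ?thesis by blast
      qed
    qed (use BZ direct z in auto)
  qed
  then have "card (N \<inter> (insert y B \<union> E `` insert y B)) \<le> card (insert y (Z \<union> U))"
    using fZ fB N_facts(1) unfolding U_def by (intro card_mono) auto
  also have "\<dots> \<le> Suc (card (Z \<union> U))" by (rule card_insert_le_m1) simp_all
  also have "card (Z \<union> U) \<le> card Z + card U" by (rule card_Un_le)
  also have "card U \<le> (\<Sum>u\<in>B \<inter> N. card (N \<inter> E `` {u} - {y}))"
    unfolding U_def using fB by (intro card_UN_le) auto
  also have "\<dots> \<le> (\<Sum>u\<in>B \<inter> N. 1)"
  proof (rule sum_mono)
    fix u assume u: "u \<in> B \<inter> N"
    then have "y \<in> N \<inter> E `` {u}" using y E_sym unfolding B_def by auto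
    moreover have "finite (N \<inter> E `` {u})" using N_facts(1) by blast
    moreover have "card (N \<inter> E `` {u}) \<le> 2" using u inner_nbrs[of u] unfolding B_def by blast
    ultimately show "card (N \<inter> E `` {u} - {y}) \<le> 1" by simp
  qed
  finally have R: "card (N \<inter> (insert y B \<union> E `` insert y B)) \<le> 3 + card (B \<inter> N)" using Z by simp
  \<comment> \<open>The neighbours of \<open>y\<close> on the cycle and those in
    \<open>B \<inter> N\<close> are all ends of arms, and there are at most two arms. This trades
    off the dominated set against the degree.\<close>
  define T where "T = E `` {y} \<inter> {r\<^sub>0, s\<^sub>0}"
  have "T \<inter> (B \<inter> N) = {}" using side_notin[OF F(1)] F(2) unfolding T_def B_def by auto
  moreover have "T \<subseteq> Z" using direct F(4,5) unfolding T_def by auto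
  ultimately have "card T + card (B \<inter> N) \<le> card Z"
    using BZ fZ fB by (subst card_Un_disjoint[symmetric]) (auto intro: card_mono simp: T_def)
  then have T: "card T + card (B \<inter> N) \<le> 2" using Z by simp
  have tb: "card (B \<inter> N) \<le> card B" using fB by (intro card_mono) auto
  have "E `` {y} \<subseteq> insert x (T \<union> W\<^sub>0 \<union> B)"
    using side_edge[OF F(1) y(2)] F(2) unfolding T_def B_def by auto
  then have "card (E `` {y}) \<le> card (insert x (T \<union> W\<^sub>0 \<union> B))"
    using fB F(12) by (intro card_mono) (auto simp: T_def)
  also have "\<dots> \<le> Suc (card (T \<union> W\<^sub>0 \<union> B))" by (rule card_insert_le_m1) simp_all
  also have "card (T \<union> W\<^sub>0 \<union> B) \<le> card T + card W\<^sub>0 + card B"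
    using card_Un_le[of "T \<union> W\<^sub>0" B] card_Un_le[of T "W\<^sub>0"] by linarith
  finally have d: "card (E `` {y}) \<le> card B + card T + 2" using F(11) by simp
  have "card B * 25 \<le> card B * card N" using hub_degree by (rule mult_left_mono) simp
  also have "\<dots> < (card (N \<inter> (insert y B \<union> E `` insert y B)) + 1 + card (B \<inter> N)) * card (E `` {y})"
    using y(1) xn by (intro star) (auto simp: B_def)
  also have "\<dots> \<le> (4 + 2 * card (B \<inter> N)) * (card B + card T + 2)"
    using R d by (intro mult_mono) auto
  finally have ineq: "card B * 25 < (4 + 2 * card (B \<inter> N)) * (card B + card T + 2)" .
  \<comment> \<open>These cases exhaust the trade-off. The right-hand sides are 4 * (b + 4), 6 * (b
    + 3) and 8 * (b + 2) for \<open>b = card B\<close>, each too small for a nonempty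
    \<open>B\<close>.\<close>
  consider "card (B \<inter> N) = 0" | "card (B \<inter> N) = 1" "card T \<le> 1" | "card (B \<inter> N) = 2" "card T = 0"
    using T by linarith
  then have "card B = 0"
  proof cases
    case 1
    have "(4 + 2 * card (B \<inter> N)) * (card B + card T + 2) \<le> 4 * (card B + 4)"
      using 1 T by simp
    with ineq have "card B * 25 < 4 * (card B + 4)" by (rule less_le_trans)
    then show ?thesis by arith
  next
    case 2
    have "(4 + 2 * card (B \<inter> N)) * (card B + card T + 2) \<le> 6 * (card B + 3)"
      using 2 by simp
    with ineq have "card B * 25 < 6 * (card B + 3)" by (rule less_le_trans)
    then show ?thesis by arith
  next
    case 3
    have "(4 + 2 * card (B \<inter> N)) * (card B + card T + 2) \<le> 8 * (card B + 2)"
      using 3 by simp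
    with ineq have "card B * 25 < 8 * (card B + 2)" by (rule less_le_trans)
    then show ?thesis using 3 tb by arith
  qed
  then have "B = {}" using fB by simp
  then show ?thesis using side_edge[OF F(1) y(2)] F(2) unfolding B_def by blast
qed

text \<open>
  The path \<open>r\<^sub>0 y s\<^sub>0\<close> splits the region. Another neighbour of the hub lies in the part bounded by
  the hub, hence in one of the two fans of \<open>y\<close>, and these are empty.
\<close>

lemma two_ends_unique:
  assumes y: "y \<in> N" "y \<in> side F\<^sub>0" "(r\<^sub>0, y) \<in> E" "(s\<^sub>0, y) \<in> E"
  shows "N \<inter> side F\<^sub>0 = {y}"
proof (rule ccontr)
  assume "\<not> ?thesis"
  then obtain u where u: "u \<in> N" "u \<in> side F\<^sub>0" "u \<noteq> y" using y by blast
  note F = cut_facts[OF cut\<^sub>0]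
  have rsV: "r\<^sub>0 \<in> V" "s\<^sub>0 \<in> V" "y \<in> V" "u \<in> V" using F(4,5) y(1) u(1) N_facts(3) by auto
  have ne: "y \<notin> {x, r\<^sub>0, s\<^sub>0} \<union> W\<^sub>0" using side_notin[OF F(1) y(2)] F(2) by blast
  have ne': "u \<notin> {x, r\<^sub>0, s\<^sub>0} \<union> W\<^sub>0" using side_notin[OF F(1) u(2)] F(2) by blast
  have nx: "r\<^sub>0 \<noteq> x" "s\<^sub>0 \<noteq> x" using F(4,5) N_facts(4) by auto
  define H where "H = {{r\<^sub>0, x}, {x, s\<^sub>0}}"
  define Y where "Y = {{r\<^sub>0, y}, {y, s\<^sub>0}}"
  have pH: "path_edges H r\<^sub>0 s\<^sub>0" unfolding H_def
    using F(4-6) nx N_facts(5) by (intro path_edges.intros) auto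
  have pY: "path_edges Y r\<^sub>0 s\<^sub>0" unfolding Y_def
    using F(6) ne y(3) E_sym[OF y(4)] by (intro path_edges.intros) auto
  \<comment> \<open>The three paths from \<open>r\<^sub>0\<close> to \<open>s\<^sub>0\<close> are
    \<open>H\<close> through the hub, \<open>Y\<close> through \<open>y\<close>, and
    \<open>G\<close>, the rest of the cycle.\<close>
  obtain G where G: "F\<^sub>0 = H \<union> G" "path_edges G r\<^sub>0 s\<^sub>0" "\<Union>G = {r\<^sub>0, s\<^sub>0} \<union> W\<^sub>0"
  proof -
    consider "W\<^sub>0 = {}" "(r\<^sub>0, s\<^sub>0) \<in> E" "F\<^sub>0 = spoke r\<^sub>0 \<union> via s\<^sub>0 r\<^sub>0"
      | w where "W\<^sub>0 = {w}" "w \<notin> N" "w \<noteq> x" "(r\<^sub>0, w) \<in> E" "(s\<^sub>0, w) \<in> E" "F\<^sub>0 = via r\<^sub>0 w \<union> via s\<^sub>0 w"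
      using cut\<^sub>0 unfolding cut_def by blast
    then show thesis
    proof cases
      case 1
      show thesis
        by (rule that[of "{{r\<^sub>0, s\<^sub>0}}"])
          (use 1 in \<open>auto simp: H_def spoke_def via_def insert_commute intro: path_edges.single\<close>)
    next
      case 2
      have "r\<^sub>0 \<noteq> w" using 2(2) F(4) by blast
      then have "path_edges {{r\<^sub>0, w}, {w, s\<^sub>0}} r\<^sub>0 s\<^sub>0"
        using F(6) by (intro path_edges.step[OF 2(4) path_edges.single[OF E_sym[OF 2(5)]]]) auto
      moreover have "F\<^sub>0 = H \<union> {{r\<^sub>0, w}, {w, s\<^sub>0}}"
        unfolding 2(6) H_def via_def by (auto simp: insert_commute)
      ultimately show thesis using 2(1) by (intro that) auto
    qed
  qed
  have UH: "\<Union>H = {r\<^sub>0, x, s\<^sub>0}" and UY: "\<Union>Y = {r\<^sub>0, y, s\<^sub>0}" unfolding H_def Y_def by auto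
  have encY: "enclosed Y"
    using enclosed_edge[OF y(2) E_sym[OF y(3)]] enclosed_edge[OF y(2) E_sym[OF y(4)]]
      enclosed_Un[of "{{y, r\<^sub>0}}" "{{y, s\<^sub>0}}"]
    unfolding Y_def by (simp add: insert_commute)
  have "H \<subseteq> F\<^sub>0" "G \<subseteq> F\<^sub>0" using G(1) by auto
  then have HG: "enclosed H" "enclosed G"
    using F(1) drawn_mono[of _ "F\<^sub>0"] unfolding enclosed_def by blast+
  have xG: "x \<notin> \<Union>G" unfolding G(3) using nx F(8) by blast
  interpret th: theta "drawn H" "drawn G" "drawn Y" "p r\<^sub>0" "p s\<^sub>0" a
  proof (rule theta_paths[OF pH G(2) pY])
    have "x \<notin> e" if "e \<in> G" for e using xG that by blast
    then show "H \<inter> G = {}" unfolding H_def by blast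
    have "y \<notin> e" if "e \<in> G \<or> e \<in> H" for e using ne G(3) UH that by blast
    then show "H \<inter> Y = {}" "G \<inter> Y = {}" unfolding Y_def by blast+
    show "\<Union>H \<inter> \<Union>G \<subseteq> {r\<^sub>0, s\<^sub>0}" "\<Union>H \<inter> \<Union>Y \<subseteq> {r\<^sub>0, s\<^sub>0}" "\<Union>G \<inter> \<Union>Y \<subseteq> {r\<^sub>0, s\<^sub>0}"
      unfolding UH UY G(3) using ne F(8) nx by auto
    show "a \<notin> drawn H" "a \<notin> drawn G" "a \<notin> drawn Y" using ref_enclosed HG encY by blast+
  qed
  have Ye: "Y \<subseteq> edges" and Ge: "G \<subseteq> edges" using encY HG(2) unfolding enclosed_def by auto
  have subGY: "far_side a (drawn (G \<union> Y)) \<subseteq> far_side a (drawn F\<^sub>0)"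
    unfolding drawn_Un[of G]
    by (rule far_side_nested[OF F(3) ref\<^sub>0 _ th.jordans(3)]) (use encY HG in \<open>auto simp: enclosed_def\<close>)
  \<comment> \<open>The hub is not on \<open>G \<union> Y\<close>, so a neighbour \<open>u\<close>
    inside that cycle would pull the hub strictly into the region.\<close>
  have "p u \<notin> far_side a (drawn (G \<union> Y))"
  proof
    assume "p u \<in> far_side a (drawn (G \<union> Y))"
    then have "p x \<in> far_side a (drawn (G \<union> Y)) \<or> x \<in> \<Union>(G \<union> Y)"
      using edge_from_side(2)[of "G \<union> Y" u x a] N_facts(5)[OF u(1)] Ye Ge by blast
    moreover have "x \<notin> \<Union>(G \<union> Y)" using xG UY nx ne by auto
    ultimately have "x \<in> side F\<^sub>0" using subGY hub_in_V unfolding side_def by blast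
    then show False using side_notin[OF F(1)] F(2) by blast
  qed
  moreover have "p u \<notin> drawn Y" using p_in_drawn[OF Ye rsV(4)] UY u(3) ne' by simp
  ultimately have "p u \<in> far_side a (drawn H \<union> drawn Y)"
    using th.split u(2) unfolding side_def G(1) drawn_Un by blast
  moreover have "drawn H \<union> drawn Y = drawn (via r\<^sub>0 y) \<union> drawn (via s\<^sub>0 y)"
    unfolding drawn_Un[symmetric] by (rule arg_cong[of _ _ drawn]) (auto simp: H_def Y_def via_def insert_commute)
  ultimately have pu: "p u \<in> far_side a (drawn (via r\<^sub>0 y) \<union> drawn (via s\<^sub>0 y))" by simp
  have tf: "theta (drawn (spoke y)) (drawn (via r\<^sub>0 y)) (drawn (via s\<^sub>0 y)) (p x) (p y) a"
    by (rule theta_fan[OF y(1,2) F(4) y(3) F(5) y(4) F(6)])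
  have us: "p u \<notin> drawn (spoke y)"
    using p_in_drawn[of "spoke y" u] rsV(4) u(3) ne' path_edges_arc[OF path_spoke[OF y(1)]]
    by (auto simp: Union_paths)
  \<comment> \<open>The cycle \<open>H \<union> Y\<close> passes through both the hub and
    \<open>y\<close>, so the spoke of \<open>y\<close> cuts its far side into the two
    triangles.\<close>
  have "far_side a (drawn (via r\<^sub>0 y) \<union> drawn (via s\<^sub>0 y)) \<subseteq>
    far_side a (drawn (spoke y) \<union> drawn (via r\<^sub>0 y)) \<union> far_side a (drawn (spoke y) \<union> drawn (via s\<^sub>0 y)) \<union> drawn (spoke y)"
    using theta.split[OF theta.swap23[OF theta.swap12[OF tf]]] by (simp add: Un_commute)
  then have "u \<in> side (fan y r\<^sub>0) \<union> side (fan y s\<^sub>0)"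
    using pu us rsV(4) unfolding side_def fan_def drawn_Un by blast
  then show False
    using fan_empty[OF y(1,2) F(4) y(3)] fan_empty[OF y(1,2) F(5) y(4)] u(1) by blast
qed

text \<open>The path from the hub through \<open>y\<close> to \<open>w\<close> divides the region
  into a part at \<open>e\<close> and a part at \<open>f\<close>. Adjacency to \<open>e\<close> puts
  \<open>u\<close> into the part at \<open>e\<close>, and by symmetry \<open>y\<close> into the part
  between \<open>e\<close> and \<open>u\<close>. Nesting then places \<open>y\<close> strictly
  inside a part on whose boundary it lies.\<close>

lemma end_unique:
  assumes w: "W\<^sub>0 = {w}" and e: "{e, f} = {r\<^sub>0, s\<^sub>0}"
    and y: "y \<in> N" "y \<in> side F\<^sub>0" "(y, e) \<in> E" "(y, w) \<in> E"
    and u: "u \<in> N" "u \<in> side F\<^sub>0" "(u, e) \<in> E" "(u, w) \<in> E"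
  shows "y = u"
proof (rule ccontr)
  assume ne: "y \<noteq> u"
  note F = cut_facts[OF cut\<^sub>0]
  have W: "w \<notin> N" "w \<noteq> x" "(r\<^sub>0, w) \<in> E" "(s\<^sub>0, w) \<in> E" "F\<^sub>0 = via r\<^sub>0 w \<union> via s\<^sub>0 w"
    using cut\<^sub>0 w unfolding cut_def by auto
  have ef: "e \<in> N" "f \<in> N" "e \<noteq> f" "(e, w) \<in> E" "(f, w) \<in> E" "F\<^sub>0 = via e w \<union> via f w"
    using e F(4-6) W(3-5) by (auto simp: doubleton_eq_iff)
  have off: "v \<notin> {x, e, f, w}" if "v \<in> side F\<^sub>0" for v
    using side_notin[OF F(1) that] F(2) e unfolding w by auto
  have enc: "enclosed (via z w)" if "z \<in> N" "z \<in> side F\<^sub>0" "(z, w) \<in> E" for z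
  proof -
    have "via z w = spoke z \<union> {{z, w}}" by (auto simp: via_def spoke_def)
    then show ?thesis
      using enclosed_Un[OF enclosed_spoke[OF that(1)] enclosed_edge[OF that(2,3)]] that(2) by simp
  qed
  have "via e w \<subseteq> F\<^sub>0" "via f w \<subseteq> F\<^sub>0" using ef(6) by auto
  then have ence: "enclosed (via e w)" "enclosed (via f w)"
    using F(1) drawn_mono[of _ "F\<^sub>0"] unfolding enclosed_def by blast+
  have th: "theta (drawn (via z w)) (drawn (via z' w)) (drawn (via z'' w)) (p x) (p w) a"
    if z: "z \<in> N" "z' \<in> N" "z'' \<in> N" "(z, w) \<in> E" "(z', w) \<in> E" "(z'', w) \<in> E" "z \<noteq> z'" "z \<noteq> z''" "z' \<noteq> z''"
      "enclosed (via z w)" "enclosed (via z' w)" "enclosed (via z'' w)" for z z' z''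
  proof (rule theta_paths)
    show "path_edges (via z w) x w" "path_edges (via z' w) x w" "path_edges (via z'' w) x w"
      using z W by (auto intro!: path_via)
    show "a \<notin> drawn (via z w)" "a \<notin> drawn (via z' w)" "a \<notin> drawn (via z'' w)"
      using z(10-12) ref_enclosed by blast+
  qed (use z W N_facts(4) E_irrefl in \<open>auto simp: via_def doubleton_eq_iff\<close>)
  have key: "p u \<in> far_side a (drawn (via e w) \<union> drawn (via y w)) \<and>
      far_side a (drawn (via e w) \<union> drawn (via y w)) \<subseteq> far_side a (drawn F\<^sub>0) \<and>
      drawn (via y w) - {p x, p w} \<subseteq> far_side a (drawn (via e w) \<union> drawn (via f w))"
    if y: "y \<in> N" "y \<in> side F\<^sub>0" "(y, e) \<in> E" "(y, w) \<in> E"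
      and u: "u \<in> N" "u \<in> side F\<^sub>0" "(u, e) \<in> E" "(u, w) \<in> E" and ne: "y \<noteq> u" for y u
  proof -
    interpret th: theta "drawn (via e w)" "drawn (via f w)" "drawn (via y w)" "p x" "p w" a
      using ef y off[OF y(2)] ence enc[OF y(1,2,4)] by (intro th) auto
    have uV: "u \<in> V" "e \<in> V" "y \<in> V" using u(1) ef(1) y(1) N_facts(3) by auto
    have py: "path_edges (via y w) x w" using y W by (intro path_via) auto
    have pf: "path_edges (via f w) x w" using ef W by (intro path_via) auto
    have "p y \<in> drawn (via y w) - {p x, p w}"
      using off[OF y(2)] uV by (intro in_path_interior[OF py]) (auto simp: Union_paths)
    then have mid: "drawn (via y w) - {p x, p w} \<subseteq> far_side a (drawn (via e w) \<union> drawn (via f w))"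
      using th.interior_dichotomy y(2) unfolding side_def ef(6) drawn_Un by blast
    note sub = th.subset_of_middle[OF mid]
    have FG: "via f w \<union> via y w \<subseteq> edges" using path_edges_arc[OF py] path_edges_arc[OF pf] by blast
    have "p u \<notin> far_side a (drawn (via f w) \<union> drawn (via y w))"
    proof
      assume "p u \<in> far_side a (drawn (via f w) \<union> drawn (via y w))"
      then have "p e \<in> far_side a (drawn (via f w \<union> via y w)) \<or> e \<in> \<Union>(via f w \<union> via y w)"
        using edge_from_side(2)[OF FG u(3)] by (simp add: drawn_Un)
      moreover have "e \<notin> \<Union>(via f w \<union> via y w)"
        using ef N_facts(4)[OF ef(1)] off[OF y(2)] W(1) by (auto simp: Union_paths)
      ultimately have "e \<in> side F\<^sub>0" using sub(2) uV unfolding side_def ef(6) drawn_Un by blast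
      then show False using off by blast
    qed
    moreover have "p u \<notin> drawn (via y w)"
      using p_in_drawn[of "via y w" u] path_edges_arc[OF py] uV off[OF u(2)] ne by (auto simp: Union_paths)
    ultimately have "p u \<in> far_side a (drawn (via e w) \<union> drawn (via y w))"
      using th.split u(2) unfolding side_def ef(6) drawn_Un by blast
    then show ?thesis using sub mid unfolding ef(6) drawn_Un by blast
  qed
  note ky = key[OF y u ne] and ku = key[OF u y ne[symmetric]]
  interpret ty: theta "drawn (via e w)" "drawn (via y w)" "drawn (via u w)" "p x" "p w" a
    using ef y u ne off[OF y(2)] off[OF u(2)] ence enc[OF y(1,2,4)] enc[OF u(1,2,4)] by (intro th) auto
  have pu: "path_edges (via u w) x w" using u W by (intro path_via) auto
  have py: "path_edges (via y w) x w" using y W by (intro path_via) auto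
  have "p u \<in> drawn (via u w)" "p y \<in> drawn (via y w)"
    using p_in_drawn[of "via u w" u] p_in_drawn[of "via y w" y] path_edges_arc[OF py] path_edges_arc[OF pu]
      N_facts(3)[OF y(1)] N_facts(3)[OF u(1)] by (auto simp: Union_paths)
  then have "drawn (via u w) - {p x, p w} \<subseteq> far_side a (drawn (via e w) \<union> drawn (via y w))"
    using ty.interior_dichotomy ky by blast
  from ty.subset_of_middle(1)[OF this] have "p y \<in> far_side a (drawn (via e w) \<union> drawn (via y w))"
    using ku by blast
  then show False using \<open>p y \<in> drawn (via y w)\<close> far_side_disjoint by blast
qed

text \<open>Degree at least 3 makes each hub neighbour in the region adjacent to two further
  vertices of the cycle. Both ends \<open>r\<^sub>0\<close>, \<open>s\<^sub>0\<close> would make it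
  the only one, so it sees the fourth vertex \<open>w\<close> and one end. Each end serves at most
  one, so there are at most two.\<close>

lemma no_minimal_region: False
proof -
  note F = cut_facts[OF cut\<^sub>0]
  define I where "I = N \<inter> side F\<^sub>0"
  have fI: "finite I" using N_facts(1) unfolding I_def by blast
  have I3: "3 \<le> card I" using side_N_card unfolding I_def .
  have not2: "\<not> ((r\<^sub>0, y) \<in> E \<and> (s\<^sub>0, y) \<in> E)" if "y \<in> I" for y
    using two_ends_unique[of y] that I3 unfolding I_def by auto
  have deg: "\<not> E `` {y} \<subseteq> {x, v}" if "y \<in> I" for y v
  proof
    assume "E `` {y} \<subseteq> {x, v}"
    then have "card (E `` {y}) \<le> card {x, v}" by (intro card_mono) auto
    also have "\<dots> \<le> 2" by (simp add: card_insert_if)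
    finally show False using min_degree[of y] that N_facts(3) unfolding I_def by fastforce
  qed
  have sub: "E `` {y} \<subseteq> {x, r\<^sub>0, s\<^sub>0} \<union> W\<^sub>0" if "y \<in> I" for y
    using side_nbrs that unfolding I_def by blast
  have "W\<^sub>0 \<noteq> {}"
  proof
    assume W: "W\<^sub>0 = {}"
    obtain y where y: "y \<in> I" using I3 by fastforce
    have "E `` {y} \<subseteq> {x, r\<^sub>0} \<or> E `` {y} \<subseteq> {x, s\<^sub>0}"
      using sub[OF y] not2[OF y] E_sym unfolding W by blast
    then show False using deg[OF y] by blast
  qed
  then obtain w where w: "W\<^sub>0 = {w}" using cut\<^sub>0 unfolding cut_def by auto
  have nb: "(y, w) \<in> E \<and> ((y, r\<^sub>0) \<in> E \<or> (y, s\<^sub>0) \<in> E)" if y: "y \<in> I" for y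
  proof -
    have *: "E `` {y} \<subseteq> {x, r\<^sub>0, w} \<or> E `` {y} \<subseteq> {x, s\<^sub>0, w}"
      using sub[OF y] not2[OF y] E_sym unfolding w by blast
    have "\<not> E `` {y} \<subseteq> {x, w}" "\<not> E `` {y} \<subseteq> {x, r\<^sub>0}" "\<not> E `` {y} \<subseteq> {x, s\<^sub>0}" using deg[OF y] by blast+
    then show ?thesis using * by blast
  qed
  have "card {y \<in> I. (y, e) \<in> E} \<le> 1" if "{e, f} = {r\<^sub>0, s\<^sub>0}" for e f
  proof -
    have "finite {y \<in> I. (y, e) \<in> E}" using fI by simp
    moreover have "y = u" if "y \<in> {y \<in> I. (y, e) \<in> E}" "u \<in> {y \<in> I. (y, e) \<in> E}" for y u
    proof (rule end_unique[OF w \<open>{e, f} = {r\<^sub>0, s\<^sub>0}\<close>])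
      show "y \<in> N" "y \<in> side F\<^sub>0" "u \<in> N" "u \<in> side F\<^sub>0" "(y, e) \<in> E" "(u, e) \<in> E"
        using that unfolding I_def by auto
      show "(y, w) \<in> E" "(u, w) \<in> E" using that nb by auto
    qed
    ultimately show ?thesis using card_le_Suc0_iff_eq[of "{y \<in> I. (y, e) \<in> E}"] by simp
  qed
  from this[of "r\<^sub>0" "s\<^sub>0"] this[of "s\<^sub>0" "r\<^sub>0"]
  have "card {y \<in> I. (y, r\<^sub>0) \<in> E} \<le> 1" "card {y \<in> I. (y, s\<^sub>0) \<in> E} \<le> 1" by (auto simp: insert_commute)
  moreover have "I = {y \<in> I. (y, r\<^sub>0) \<in> E} \<union> {y \<in> I. (y, s\<^sub>0) \<in> E}" using nb by blast
  ultimately have "card I \<le> 2"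
    using card_Un_le[of "{y \<in> I. (y, r\<^sub>0) \<in> E}" "{y \<in> I. (y, s\<^sub>0) \<in> E}"] by simp
  then show False using I3 by simp
qed

end

lemma (in hub) degree_too_large: False
proof -
  \<comment> \<open>Without short cycles, \<open>y\<close> together with all its neighbours except
    the hub dominates only \<open>y\<close> itself. The inequality then reads
    \<open>25 * b < 2 * (b + 1)\<close>, although \<open>b\<close> is at least 2.\<close>
  have "\<exists>F r s W. cut F r s W"
  proof (rule ccontr)
    assume no: "\<nexists>F r s W. cut F r s W"
    obtain y where y: "y \<in> N" using hub_degree by (cases "N = {}") auto
    define B where "B = E `` {y} - {x}"
    have yV: "y \<in> V" using y N_facts(3) by blast
    have B: "B \<inter> N = {}" using no cut_spoke_via[of y] y E_sym unfolding B_def by blast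
    have "z = y" if zN: "z \<in> N" and zE: "z \<in> E `` insert y B" for z
    proof (rule ccontr)
      assume ne: "z \<noteq> y"
      then have "(y, z) \<notin> E" using B zN N_facts(4)[OF zN] unfolding B_def by blast
      then obtain w where w: "w \<in> B" "(w, z) \<in> E" using zE by blast
      then have "cut (via y w \<union> via z w) y z {w}"
        using B zN y ne E_sym[OF w(2)] unfolding B_def by (intro cut_via_via) auto
      then show False using no by blast
    qed
    then have "N \<inter> (insert y B \<union> E `` insert y B) \<subseteq> {y}" using B by blast
    then have "card (N \<inter> (insert y B \<union> E `` insert y B)) \<le> 1" using card_mono[of "{y}"] by fastforce
    moreover have "card B * card N < (card (N \<inter> (insert y B \<union> E `` insert y B)) + 1 + card (B \<inter> N)) * card (E `` {y})"
      using y by (intro star) (auto simp: B_def)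
    moreover have "card (B \<inter> N) = 0" using B by simp
    moreover have "card B + 1 = card (E `` {y})"
      using card_Suc_Diff1[of "E `` {y}" x] locally_finite[OF yV] N_facts(5)[OF y] unfolding B_def by simp
    moreover have "card B * 25 \<le> card B * card N" using hub_degree by (rule mult_left_mono) simp
    moreover have "(card (N \<inter> (insert y B \<union> E `` insert y B)) + 1 + card (B \<inter> N)) * card (E `` {y}) \<le> 2 * (card B + 1)"
      using calculation(1,3,4) by (intro mult_mono) auto
    ultimately have "card B * 25 < 2 * (card B + 1)" by linarith
    then have "card B = 0" by simp
    then show False using \<open>card B + 1 = card (E `` {y})\<close> min_degree[OF yV] by simp
  qed
  then obtain F1 r1 s1 W1 where c1: "cut F1 r1 s1 W1" by blast
  note F1 = cut_facts[OF c1]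
  \<comment> \<open>Either side of the cycle is the far side for a suitable reference point. At
    least 23 hub neighbours are off the cycle, so one side has three of them.\<close>
  obtain b where b: "b \<notin> drawn F1" "far_side b (drawn F1) \<noteq> {}"
  proof -
    obtain g where g: "simple_path g" "pathfinish g = pathstart g" "path_image g = drawn F1"
      using F1(3) unfolding jordan_def by blast
    then obtain b where "b \<in> inside (drawn F1)" using Jordan_inside_outside[OF g(1,2)] by auto
    then have "b \<notin> drawn F1" using inside_no_overlap[of "drawn F1"] by blast
    then show thesis using that jordan_far_side(4)[OF F1(3)] by blast
  qed
  then obtain b' where b': "b' \<in> far_side b (drawn F1)" by blast
  then have nb': "b' \<notin> drawn F1" by (simp add: far_side_def)
  let ?I = "\<lambda>a F. {z \<in> N. p z \<in> far_side a (drawn F)}"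
  have "N \<subseteq> ?I b F1 \<union> ?I b' F1 \<union> {r1, s1}"
  proof
    fix z assume z: "z \<in> N"
    have "z \<in> {r1, s1}" if "p z \<in> drawn F1"
      using that p_in_drawn[OF F1(1) N_facts(3)[OF z]] F1(2,7) z N_facts(4)[OF z] by auto
    moreover have "p z \<in> far_side b (drawn F1) \<union> far_side b' (drawn F1)" if "p z \<notin> drawn F1"
      using that jordan_far_side(6,7)[OF F1(3) b(1)] b' by blast
    ultimately show "z \<in> ?I b F1 \<union> ?I b' F1 \<union> {r1, s1}" using z by blast
  qed
  moreover have "finite (?I a F)" for a F by (rule finite_subset[OF _ N_facts(1)]) auto
  ultimately have "card N \<le> card (?I b F1 \<union> ?I b' F1 \<union> {r1, s1})"
    by (intro card_mono) simp_all
  also have "\<dots> \<le> card (?I b F1) + card (?I b' F1) + card {r1, s1}"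
    using card_Un_le[of "?I b F1 \<union> ?I b' F1" "{r1, s1}"] card_Un_le[of "?I b F1" "?I b' F1"] by linarith
  also have "card {r1, s1} \<le> 2" by (simp add: card_insert_if)
  finally have "3 \<le> card (?I b F1) \<or> 3 \<le> card (?I b' F1)" using hub_degree by linarith
  then obtain a where a: "a \<notin> drawn F1" "3 \<le> card (?I a F1)" using b(1) nb' by blast
  define \<C> where "\<C> = {F. (\<exists>r s W. cut F r s W) \<and> a \<notin> drawn F \<and> 3 \<le> card (?I a F)}"
  \<comment> \<open>The possible fourth vertex is adjacent to a hub neighbour, so local finiteness
    leaves finitely many candidates for a minimal side.\<close>
  have "finite {F. \<exists>r s W. cut F r s W}"
  proof (rule finite_subset)
    show "{F. \<exists>r s W. cut F r s W} \<subseteq> (\<lambda>(r, s). spoke r \<union> via s r) ` (N \<times> N)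
      \<union> (\<lambda>(r, s, w). via r w \<union> via s w) ` (N \<times> N \<times> (E `` N))"
      unfolding cut_def by auto
    show "finite ((\<lambda>(r, s). spoke r \<union> via s r) ` (N \<times> N) \<union> (\<lambda>(r, s, w). via r w \<union> via s w) ` (N \<times> N \<times> (E `` N)))"
    proof -
      have "E `` N = (\<Union>z\<in>N. E `` {z})" by auto
      then have "finite (E `` N)" using N_facts(1,3) locally_finite by auto
      then show ?thesis using N_facts(1) by blast
    qed
  qed
  then have "finite \<C>" unfolding \<C>_def by (rule rev_finite_subset) auto
  moreover have "F1 \<in> \<C>" unfolding \<C>_def using c1 a by blast
  ultimately obtain A where A: "A \<in> (\<lambda>F. far_side a (drawn F)) ` \<C>"
    "\<forall>B\<in>(\<lambda>F. far_side a (drawn F)) ` \<C>. B \<subseteq> A \<longrightarrow> A = B"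
    using finite_has_minimal[of "(\<lambda>F. far_side a (drawn F)) ` \<C>"] by auto
  then obtain F0 where F0: "F0 \<in> \<C>" "A = far_side a (drawn F0)" by blast
  then obtain r0 s0 W0 where c0: "cut F0 r0 s0 W0" "a \<notin> drawn F0" "3 \<le> card (?I a F0)" unfolding \<C>_def by blast
  interpret hub_region V E p c x a F0 r0 s0 W0
  proof unfold_locales
    show "cut F0 r0 s0 W0" "a \<notin> drawn F0" "3 \<le> card (?I a F0)" using c0 by blast+
    fix F r s W assume F: "cut F r s W" "a \<notin> drawn F" "far_side a (drawn F) \<subset> far_side a (drawn F0)"
    show "card (?I a F) \<le> 2"
    proof (rule ccontr)
      assume "\<not> ?thesis"
      then have "F \<in> \<C>" unfolding \<C>_def using F by auto
      then show False using A(2) F(3) unfolding F0(2) by blast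
    qed
  qed
  show False by (rule no_minimal_region)
qed

subsection \<open>Curvature and the Laplacian\<close>

definition laplacian :: "'a rel \<Rightarrow> ('a \<Rightarrow> real) \<Rightarrow> 'a \<Rightarrow> real" where
  "laplacian E f v = (\<Sum>z\<in>E `` {v}. f z - f v) / real (card (E `` {v}))"

definition edge_lipschitz :: "'a rel \<Rightarrow> ('a \<Rightarrow> real) \<Rightarrow> bool" where
  "edge_lipschitz E f \<longleftrightarrow> (\<forall>(s, t)\<in>E. \<bar>f s - f t\<bar> \<le> 1)"

lemma edge_lipschitz_walk:
  assumes "edge_lipschitz E f" "(s, t) \<in> E ^^ n"
  shows "\<bar>f s - f t\<bar> \<le> real n"
  using assms(2)
proof (induction n arbitrary: t)
  case (Suc n)
  then obtain u where u: "(s, u) \<in> E ^^ n" "(u, t) \<in> E" by auto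
  have "\<bar>f u - f t\<bar> \<le> 1" using assms(1) u(2) unfolding edge_lipschitz_def by auto
  then show ?case using Suc.IH[OF u(1)] by simp
qed simp

lemma graph_dist_walk:
  assumes "(s, t) \<in> E\<^sup>*"
  shows "(s, t) \<in> E ^^ graph_dist E s t"
proof -
  obtain n where "(s, t) \<in> E ^^ n" using assms rtrancl_imp_relpow by blast
  then show ?thesis unfolding graph_dist_def by (rule LeastI)
qed

lemma graph_dist_le: "(s, t) \<in> E ^^ n \<Longrightarrow> graph_dist E s t \<le> n"
  unfolding graph_dist_def by (rule Least_le)

lemma graph_dist_edge:
  assumes "(s, t) \<in> E" "s \<noteq> t"
  shows "graph_dist E s t = 1"
proof -
  have "graph_dist E s t \<le> 1" using assms(1) by (intro graph_dist_le) simp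
  moreover have "graph_dist E s t \<noteq> 0"
  proof
    assume "graph_dist E s t = 0"
    then have "(s, t) \<in> E ^^ 0" using graph_dist_walk[of s t E] assms(1) by auto
    then show False using assms(2) by simp
  qed
  ultimately show ?thesis by simp
qed

text \<open>This supplies the existence of the limit in the definition of the curvature, without
  which \<open>Lim\<close> would be an unspecified value.\<close>

lemma tendsto_at_left_mono_bounded:
  fixes h :: "real \<Rightarrow> real"
  assumes mono: "\<And>s t. a \<le> s \<Longrightarrow> s \<le> t \<Longrightarrow> t < b \<Longrightarrow> h s \<le> h t"
    and bound: "\<And>s. a \<le> s \<Longrightarrow> s < b \<Longrightarrow> h s \<le> C" and "a < b"
  shows "(h \<longlongrightarrow> (SUP s\<in>{a..<b}. h s)) (at_left b)" "(SUP s\<in>{a..<b}. h s) \<le> C"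
proof -
  have bdd: "bdd_above (h ` {a..<b})" using bound by (intro bdd_aboveI2[of _ _ C]) auto
  have ne: "{a..<b} \<noteq> {}" using \<open>a < b\<close> by simp
  show "(SUP s\<in>{a..<b}. h s) \<le> C" using bound by (intro cSUP_least ne) auto
  have nbhd: "\<forall>\<^sub>F t in at_left b. s \<le> t \<and> t < b" if "s < b" for s
    using eventually_at_left_real[OF that] by eventually_elim auto
  show "(h \<longlongrightarrow> (SUP s\<in>{a..<b}. h s)) (at_left b)"
  proof (rule order_tendstoI)
    fix y assume "y < (SUP s\<in>{a..<b}. h s)"
    then obtain s where s: "s \<in> {a..<b}" "y < h s" using less_cSUP_iff[OF ne bdd] by blast
    have "s < b" using s(1) by simp
    from nbhd[OF this] show "\<forall>\<^sub>F t in at_left b. y < h t"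
    proof eventually_elim
      case (elim t)
      then show ?case using mono[of s t] s by auto
    qed
  next
    fix y assume y: "(SUP s\<in>{a..<b}. h s) < y"
    from nbhd[OF \<open>a < b\<close>] show "\<forall>\<^sub>F t in at_left b. h t < y"
    proof eventually_elim
      case (elim t)
      then have "h t \<le> (SUP s\<in>{a..<b}. h s)" by (intro cSUP_upper bdd) auto
      then show ?case using y by simp
    qed
  qed
qed

locale lazy_graph = undirected_graph +
  assumes conn: "connected_graph V E"
    and locally_finite: "v \<in> V \<Longrightarrow> finite (E `` {v})"
begin

lemma irrefl: "irrefl E"
  using simple unfolding simple_graph_def by auto

lemma dist_walk: "s \<in> V \<Longrightarrow> t \<in> V \<Longrightarrow> (s, t) \<in> E ^^ graph_dist E s t"
  using conn unfolding connected_graph_def by (intro graph_dist_walk) auto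

lemma edge_lipschitz_dist:
  "edge_lipschitz E f \<Longrightarrow> s \<in> V \<Longrightarrow> t \<in> V \<Longrightarrow> \<bar>f s - f t\<bar> \<le> real (graph_dist E s t)"
  by (rule edge_lipschitz_walk[OF _ dist_walk])

section \<open>Transport between the lazy walks at the ends of an edge\<close>

context
  fixes v u :: 'a
  assumes vu: "(v, u) \<in> E"
begin

lemma lazy_pmf:
  assumes "0 \<le> \<alpha>" "\<alpha> < 1" "w \<in> {v, u}"
  shows "pmf (lazy_walk E \<alpha> w) i = lazy_walk_mass E \<alpha> w i"
proof (rule pmf_lazy_walk[OF irrefl _ _ assms(1,2)])
  show "finite (neighborhood E w)" "neighborhood E w \<noteq> {}"
    using assms(3) vu E_sym[OF vu] E_in_V[OF vu] locally_finite unfolding neighborhood_def by auto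
qed

lemma lazy_support:
  assumes "0 \<le> \<alpha>" "\<alpha> < 1" "w \<in> {v, u}"
  shows "set_pmf (lazy_walk E \<alpha> w) \<subseteq> insert w (E `` {w})" "finite (set_pmf (lazy_walk E \<alpha> w))"
    "set_pmf (lazy_walk E \<alpha> w) \<subseteq> V"
proof -
  show 1: "set_pmf (lazy_walk E \<alpha> w) \<subseteq> insert w (E `` {w})"
    using lazy_pmf[OF assms] by (auto simp: set_pmf_iff lazy_walk_mass_def neighborhood_def split: if_splits)
  have "w \<in> V" using assms(3) E_in_V[OF vu] by auto
  then have "finite (insert w (E `` {w}))" "insert w (E `` {w}) \<subseteq> V" using locally_finite E_in_V by auto
  then show "finite (set_pmf (lazy_walk E \<alpha> w))" "set_pmf (lazy_walk E \<alpha> w) \<subseteq> V"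
    using 1 finite_subset by blast+
qed

lemma lazy_expectation:
  assumes "0 \<le> \<alpha>" "\<alpha> < 1" "w \<in> {v, u}"
  shows "measure_pmf.expectation (lazy_walk E \<alpha> w) f = f w + (1 - \<alpha>) * laplacian E f w"
proof -
  have wV: "w \<in> V" using assms(3) E_in_V[OF vu] by auto
  have fin: "finite (E `` {w})" by (rule locally_finite[OF wV])
  have ne: "card (E `` {w}) \<noteq> 0" using fin assms(3) vu E_sym[OF vu] by auto
  have "measure_pmf.expectation (lazy_walk E \<alpha> w) f = (\<Sum>z\<in>insert w (E `` {w}). pmf (lazy_walk E \<alpha> w) z *\<^sub>R f z)"
    using fin lazy_support(1)[OF assms] by (intro integral_measure_pmf) auto
  also have "\<dots> = \<alpha> * f w + (\<Sum>z\<in>E `` {w}. pmf (lazy_walk E \<alpha> w) z *\<^sub>R f z)"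
    using fin E_irrefl lazy_pmf[OF assms] by (simp add: lazy_walk_mass_def)
  also have "(\<Sum>z\<in>E `` {w}. pmf (lazy_walk E \<alpha> w) z *\<^sub>R f z) = (\<Sum>z\<in>E `` {w}. (1 - \<alpha>) / real (card (E `` {w})) * f z)"
    using E_irrefl lazy_pmf[OF assms]
    by (intro sum.cong) (auto simp: lazy_walk_mass_def neighborhood_def vertex_degree_def)
  also have "\<dots> = (1 - \<alpha>) * ((\<Sum>z\<in>E `` {w}. f z) / real (card (E `` {w})))"
    by (simp add: sum_distrib_left sum_divide_distrib)
  also have "(\<Sum>z\<in>E `` {w}. f z) / real (card (E `` {w})) = laplacian E f w + f w"
    using ne unfolding laplacian_def by (simp add: sum_subtractf field_simps)
  finally show ?thesis by (simp add: algebra_simps)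
qed

lemma coupling_support:
  assumes "0 \<le> \<alpha>" "\<alpha> < 1" and A: "A \<in> couplings (lazy_walk E \<alpha> v) (lazy_walk E \<alpha> u)"
  shows "set_pmf A \<subseteq> set_pmf (lazy_walk E \<alpha> v) \<times> set_pmf (lazy_walk E \<alpha> u)" "finite (set_pmf A)"
proof -
  have "fst ` set_pmf A = set_pmf (lazy_walk E \<alpha> v)" "snd ` set_pmf A = set_pmf (lazy_walk E \<alpha> u)"
    using A unfolding couplings_def by (metis (mono_tags, lifting) mem_Collect_eq set_map_pmf)+
  then show 1: "set_pmf A \<subseteq> set_pmf (lazy_walk E \<alpha> v) \<times> set_pmf (lazy_walk E \<alpha> u)" by force
  have "finite (set_pmf (lazy_walk E \<alpha> v) \<times> set_pmf (lazy_walk E \<alpha> u))"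
    using lazy_support(2)[OF assms(1,2)] by auto
  then show "finite (set_pmf A)" using 1 by (rule rev_finite_subset)
qed

lemma couplings_nonempty: "couplings m m' \<noteq> {}"
proof -
  have "pair_pmf m m' \<in> couplings m m'" by (simp add: couplings_def map_fst_pair_pmf map_snd_pair_pmf)
  then show ?thesis by blast
qed

definition cost :: "('a \<times> 'a) pmf \<Rightarrow> real" where
  "cost A = measure_pmf.expectation A (\<lambda>(s, t). real (graph_dist E s t))"

lemma cost_nonneg: "0 \<le> cost A"
  unfolding cost_def by (rule Bochner_Integration.integral_nonneg) (auto split: prod.split)

lemma wasserstein_cost: "wasserstein E m m' = (INF A\<in>couplings m m'. cost A)"
  unfolding wasserstein_def cost_def by simp

text \<open>This is the easy half of Kantorovich duality: the difference of the two expectations of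
  \<open>f\<close> is an expectation under any coupling, and there it is dominated by the
  distance.\<close>

lemma wasserstein_lower:
  assumes \<alpha>: "0 \<le> \<alpha>" "\<alpha> < 1" and f: "edge_lipschitz E f"
  shows "f v - f u + (1 - \<alpha>) * (laplacian E f v - laplacian E f u)
    \<le> wasserstein E (lazy_walk E \<alpha> v) (lazy_walk E \<alpha> u)"
  unfolding wasserstein_cost
proof (rule cINF_greatest[OF couplings_nonempty])
  fix A assume A: "A \<in> couplings (lazy_walk E \<alpha> v) (lazy_walk E \<alpha> u)"
  note S = coupling_support[OF \<alpha> A]
  have int: "integrable (measure_pmf A) g" for g :: "'a \<times> 'a \<Rightarrow> real"
    by (rule integrable_measure_pmf_finite[OF S(2)])
  have m: "map_pmf fst A = lazy_walk E \<alpha> v" "map_pmf snd A = lazy_walk E \<alpha> u"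
    using A by (auto simp: couplings_def)
  have "f v - f u + (1 - \<alpha>) * (laplacian E f v - laplacian E f u)
    = measure_pmf.expectation (map_pmf fst A) f - measure_pmf.expectation (map_pmf snd A) f"
    unfolding m using lazy_expectation[OF \<alpha>, of v f] lazy_expectation[OF \<alpha>, of u f] by (simp add: algebra_simps)
  also have "\<dots> = measure_pmf.expectation A (\<lambda>e. f (fst e) - f (snd e))"
    using int by simp
  also have "\<dots> \<le> cost A" unfolding cost_def
  proof (rule integral_mono_AE[OF int int])
    show "AE e in measure_pmf A. f (fst e) - f (snd e) \<le> (case e of (s, t) \<Rightarrow> real (graph_dist E s t))"
    proof (rule AE_pmfI)
      fix e assume "e \<in> set_pmf A"
      then have "fst e \<in> set_pmf (lazy_walk E \<alpha> v)" "snd e \<in> set_pmf (lazy_walk E \<alpha> u)"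
        using S(1) by (auto simp: mem_Times_iff)
      then have "fst e \<in> V" "snd e \<in> V"
        using lazy_support(3)[OF \<alpha>, of v] lazy_support(3)[OF \<alpha>, of u] by auto
      then have "\<bar>f (fst e) - f (snd e)\<bar> \<le> real (graph_dist E (fst e) (snd e))"
        by (rule edge_lipschitz_dist[OF f])
      then show "f (fst e) - f (snd e) \<le> (case e of (s, t) \<Rightarrow> real (graph_dist E s t))"
        by (simp add: case_prod_beta)
    qed
  qed
  finally show "f v - f u + (1 - \<alpha>) * (laplacian E f v - laplacian E f u) \<le> cost A" .
qed

text \<open>
  Mixing a coupling at laziness \<open>\<alpha>\<close> with the point mass at \<open>(v, u)\<close> gives one at any greater laziness \<open>\<beta>\<close>.
\<close>

lemma wasserstein_mix:
  assumes \<alpha>: "0 \<le> \<alpha>" "\<alpha> \<le> \<beta>" "\<beta> < 1"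
  defines "\<theta> \<equiv> (1 - \<beta>) / (1 - \<alpha>)"
  shows "wasserstein E (lazy_walk E \<beta> v) (lazy_walk E \<beta> u)
    \<le> \<theta> * wasserstein E (lazy_walk E \<alpha> v) (lazy_walk E \<alpha> u) + (1 - \<theta>)"
proof -
  have \<theta>: "0 < \<theta>" "\<theta> \<le> 1" using \<alpha> unfolding \<theta>_def by auto
  have \<alpha>1: "\<alpha> < 1" and \<beta>0: "0 \<le> \<beta>" using \<alpha> by auto
  \<comment> \<open>The weight \<theta> scales 1 - \<alpha> to 1 - \<beta>, and the missing mass 1 -
    \<theta> goes to the centre.\<close>
  have mass: "pmf (lazy_walk E \<beta> w) i = pmf (lazy_walk E \<alpha> w) i * \<theta> + indicator {w} i * (1 - \<theta>)"
    if w: "w \<in> {v, u}" for w i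
  proof -
    have "(1 - \<alpha>) * \<theta> = 1 - \<beta>" using \<alpha> \<alpha>1 unfolding \<theta>_def by simp
    then have "\<beta> = \<alpha> * \<theta> + (1 - \<theta>)" "(1 - \<beta>) / d = (1 - \<alpha>) / d * \<theta>" for d by (auto simp: algebra_simps)
    then show ?thesis
      unfolding lazy_pmf[OF \<beta>0 \<alpha>(3) w] lazy_pmf[OF \<alpha>(1) \<alpha>1 w] lazy_walk_mass_def
      by (auto simp: indicator_def)
  qed
  \<comment> \<open>The bound is solved for the cost at \<alpha>, so that it holds for every
    coupling and passes to the infimum even if none is optimal.\<close>
  have step: "(wasserstein E (lazy_walk E \<beta> v) (lazy_walk E \<beta> u) - (1 - \<theta>)) / \<theta> \<le> cost A"
    if A: "A \<in> couplings (lazy_walk E \<alpha> v) (lazy_walk E \<alpha> u)" for A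
  proof -
    define A' where "A' = bind_pmf (bernoulli_pmf \<theta>) (\<lambda>b. if b then A else return_pmf (v, u))"
    have m: "map_pmf fst A = lazy_walk E \<alpha> v" "map_pmf snd A = lazy_walk E \<alpha> u"
      using A by (auto simp: couplings_def)
    have "map_pmf fst A' = lazy_walk E \<beta> v"
      unfolding A'_def map_bind_pmf
      by (rule pmf_eqI) (use \<theta> in \<open>simp add: pmf_bind mass m if_distrib[of "map_pmf _"] pmf_return indicator_def cong: if_cong\<close>)
    moreover have "map_pmf snd A' = lazy_walk E \<beta> u"
      unfolding A'_def map_bind_pmf
      by (rule pmf_eqI) (use \<theta> in \<open>simp add: pmf_bind mass m if_distrib[of "map_pmf _"] pmf_return indicator_def cong: if_cong\<close>)
    ultimately have A': "A' \<in> couplings (lazy_walk E \<beta> v) (lazy_walk E \<beta> u)" by (simp add: couplings_def)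
    let ?S = "insert (v, u) (set_pmf A)"
    have fS: "finite ?S" using coupling_support(2)[OF \<alpha>(1) \<alpha>1 A] by simp
    have pA': "pmf A' e = pmf A e * \<theta> + indicator {(v, u)} e * (1 - \<theta>)" for e
      unfolding A'_def using \<theta> by (simp add: pmf_bind pmf_return indicator_def)
    have "set_pmf A' \<subseteq> ?S" unfolding A'_def by (auto split: if_splits)
    then have "cost A' = (\<Sum>e\<in>?S. pmf A' e *\<^sub>R (case e of (s, t) \<Rightarrow> real (graph_dist E s t)))"
      unfolding cost_def using fS by (intro integral_measure_pmf) auto
    also have "\<dots> = (\<Sum>e\<in>?S. \<theta> * (pmf A e *\<^sub>R (case e of (s, t) \<Rightarrow> real (graph_dist E s t)))
        + (if e = (v, u) then (1 - \<theta>) * (case e of (s, t) \<Rightarrow> real (graph_dist E s t)) else 0))"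
      by (intro sum.cong) (auto simp: pA' indicator_def algebra_simps)
    also have "\<dots> = \<theta> * (\<Sum>e\<in>?S. pmf A e *\<^sub>R (case e of (s, t) \<Rightarrow> real (graph_dist E s t))) + (1 - \<theta>) * real (graph_dist E v u)"
      using fS by (simp add: sum.distrib sum_distrib_left sum.delta del: sum.insert)
    also have "(\<Sum>e\<in>?S. pmf A e *\<^sub>R (case e of (s, t) \<Rightarrow> real (graph_dist E s t))) = cost A"
      unfolding cost_def using fS by (intro integral_measure_pmf[symmetric]) auto
    also have "real (graph_dist E v u) = 1"
      using graph_dist_edge[OF vu] vu E_irrefl by auto
    finally have c: "cost A' = \<theta> * cost A + (1 - \<theta>)" by simp
    have "wasserstein E (lazy_walk E \<beta> v) (lazy_walk E \<beta> u) \<le> cost A'"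
      unfolding wasserstein_cost using cost_nonneg by (intro cINF_lower A' bdd_belowI) auto
    then show ?thesis using \<theta>(1) unfolding c by (simp add: field_simps)
  qed
  have "(wasserstein E (lazy_walk E \<beta> v) (lazy_walk E \<beta> u) - (1 - \<theta>)) / \<theta>
    \<le> wasserstein E (lazy_walk E \<alpha> v) (lazy_walk E \<alpha> u)"
    unfolding wasserstein_cost[of "lazy_walk E \<alpha> v"] by (rule cINF_greatest[OF couplings_nonempty step])
  then show ?thesis using \<theta>(1) by (simp add: field_simps)
qed

text \<open>The quotients are nondecreasing in \<alpha> by mixing and bounded above by weak duality.
  Hence they converge to their supremum, which obeys the same bound.\<close>

lemma LLY_curvature_le:
  assumes f: "edge_lipschitz E f" "f v = f u + 1"
  shows "LLY_curvature E v u \<le> laplacian E f u - laplacian E f v"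
proof -
  define h where "h = (\<lambda>\<alpha>. lazy_curvature E \<alpha> v u / (1 - \<alpha>))"
  define W where "W = (\<lambda>\<alpha>. wasserstein E (lazy_walk E \<alpha> v) (lazy_walk E \<alpha> u))"
  have d: "graph_dist E v u = 1" using graph_dist_edge[OF vu] vu E_irrefl by auto
  have h: "h \<alpha> = (1 - W \<alpha>) / (1 - \<alpha>)" for \<alpha> unfolding h_def W_def lazy_curvature_def d by simp
  have bound: "h \<alpha> \<le> laplacian E f u - laplacian E f v" if "0 \<le> \<alpha>" "\<alpha> < 1" for \<alpha>
  proof -
    have "1 + (1 - \<alpha>) * (laplacian E f v - laplacian E f u) \<le> W \<alpha>"
      using wasserstein_lower[OF that f(1)] f(2) unfolding W_def by simp
    then have "1 - W \<alpha> \<le> (laplacian E f u - laplacian E f v) * (1 - \<alpha>)" by (simp add: algebra_simps)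
    then show ?thesis using that unfolding h by (simp add: divide_le_eq)
  qed
  have mono: "h \<alpha> \<le> h \<beta>" if "0 \<le> \<alpha>" "\<alpha> \<le> \<beta>" "\<beta> < 1" for \<alpha> \<beta>
  proof -
    define \<theta> where "\<theta> = (1 - \<beta>) / (1 - \<alpha>)"
    have "1 - \<beta> = \<theta> * (1 - \<alpha>)" "0 < \<theta>" using that unfolding \<theta>_def by auto
    moreover have "\<theta> * (1 - W \<alpha>) \<le> 1 - W \<beta>"
      using wasserstein_mix[OF that] unfolding W_def \<theta>_def by (simp add: algebra_simps)
    ultimately have "(\<theta> * (1 - W \<alpha>)) / (1 - \<beta>) \<le> (1 - W \<beta>) / (1 - \<beta>)"
      using that by (intro divide_right_mono) auto
    moreover have "(\<theta> * (1 - W \<alpha>)) / (1 - \<beta>) = (1 - W \<alpha>) / (1 - \<alpha>)"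
      unfolding \<open>1 - \<beta> = \<theta> * (1 - \<alpha>)\<close> using \<open>0 < \<theta>\<close> by simp
    ultimately show ?thesis unfolding h by simp
  qed
  note lim = tendsto_at_left_mono_bounded[of 0 1 h, OF mono bound]
  have "LLY_curvature E v u = (SUP s\<in>{0..<1}. h s)"
    unfolding LLY_curvature_def h_def[symmetric]
    by (rule tendsto_Lim[OF trivial_limit_at_left_real lim(1)]) auto
  also have "\<dots> \<le> laplacian E f u - laplacian E f v" by (rule lim(2)) auto
  finally show ?thesis .
qed

end

end

subsection \<open>Growth of spheres\<close>

lemma sum_indicator_card:
  "finite A \<Longrightarrow> (\<Sum>z\<in>A. if P z then 1 else 0) = real (card {z \<in> A. P z})"
  by (simp add: sum.inter_filter[symmetric])

locale positive_graph = lazy_graph +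
  assumes positive: "(v, u) \<in> E \<Longrightarrow> 0 < LLY_curvature E v u"
begin

lemma laplacian_less:
  assumes "(v, u) \<in> E" "edge_lipschitz E f" "f v = f u + 1"
  shows "laplacian E f v < laplacian E f u"
  using positive[OF assms(1)] LLY_curvature_le[OF assms] by linarith

text \<open>
  The test function is the distance to \<open>B \<union> {y}\<close>, truncated at 2.
\<close>

lemma neighbour_expansion:
  assumes xy: "(x, y) \<in> E" and B: "B \<subseteq> E `` {y} - {x}"
  shows "card B * card (E `` {x}) <
    (card (E `` {x} \<inter> (insert y B \<union> E `` insert y B)) + 1 + card (B \<inter> E `` {x})) * card (E `` {y})"
proof -
  define S where "S = insert y B"
  define f where "f = (\<lambda>z. if z \<in> S then 0 else if z \<in> E `` S then 1 else (2::real))"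
  note V = E_in_V[OF xy]
  have fin: "finite (E `` {x})" "finite (E `` {y})" using locally_finite V by auto
  have BE: "B \<subseteq> E `` {y}" using B by blast
  have finB: "finite B" by (rule finite_subset[OF BE fin(2)])
  have pos: "0 < card (E `` {x})" "0 < card (E `` {y})"
    using fin xy E_sym[OF xy] by (auto simp: card_gt_0_iff)
  have lip: "edge_lipschitz E f" unfolding edge_lipschitz_def
  proof clarify
    fix s t assume "(s, t) \<in> E"
    then show "\<bar>f s - f t\<bar> \<le> 1" using E_sym[of s t] unfolding f_def by (auto simp: Image_iff)
  qed
  have xS: "x \<notin> S" using B xy E_irrefl unfolding S_def by auto
  have fx: "f x = 1" using xS E_sym[OF xy] unfolding f_def S_def by auto
  have fy: "f y = 0" unfolding f_def S_def by simp
  have "(\<Sum>z\<in>E `` {y}. f z - f y) = (\<Sum>z\<in>E `` {y}. if z \<in> B then 0 else 1)"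
  proof (rule sum.cong[OF refl])
    fix z assume "z \<in> E `` {y}"
    then have "z \<noteq> y" "z \<in> E `` S" using E_irrefl unfolding S_def by auto
    then show "f z - f y = (if z \<in> B then 0 else 1)" unfolding fy unfolding f_def S_def by simp
  qed
  also have "\<dots> = real (card (E `` {y} - B))"
    using fin(2) by (simp add: sum.If_cases Diff_eq)
  also have "\<dots> = real (card (E `` {y})) - real (card B)"
    using card_Diff_subset[OF finB BE] card_mono[OF fin(2) BE] by simp
  finally have ly: "laplacian E f y = (real (card (E `` {y})) - real (card B)) / real (card (E `` {y}))"
    unfolding laplacian_def by simp
  define R where "R = E `` {x} \<inter> (S \<union> E `` S)"
  have RN: "R \<subseteq> E `` {x}" unfolding R_def by blast
  have "(\<Sum>z\<in>E `` {x}. f z - f x) = (\<Sum>z\<in>E `` {x}. (if z \<notin> R then 1 else 0) - (if z \<in> S then 1 else 0))"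
    unfolding fx by (intro sum.cong) (auto simp: f_def R_def)
  also have "\<dots> = real (card {z \<in> E `` {x}. z \<notin> R}) - real (card {z \<in> E `` {x}. z \<in> S})"
    unfolding sum_subtractf sum_indicator_card[OF fin(1)] ..
  also have "{z \<in> E `` {x}. z \<notin> R} = E `` {x} - R" by blast
  also have "{z \<in> E `` {x}. z \<in> S} = E `` {x} \<inter> S" by blast
  also have "real (card (E `` {x} - R)) = real (card (E `` {x})) - real (card R)"
    using RN fin(1) card_mono[OF fin(1) RN] by (subst card_Diff_subset) (auto simp: of_nat_diff finite_subset)
  also have "E `` {x} \<inter> S = insert y (B \<inter> E `` {x})" using xy unfolding S_def by auto
  also have "card \<dots> = 1 + card (B \<inter> E `` {x})"
    using finB B E_irrefl by (subst card_insert_disjoint) auto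
  finally have lx: "laplacian E f x =
      (real (card (E `` {x})) - real (card R) - real (1 + card (B \<inter> E `` {x}))) / real (card (E `` {x}))"
    unfolding laplacian_def by simp
  \<comment> \<open>Both values are 1 minus a proportion. At \<open>y\<close> it is that of
    \<open>B\<close>. At \<open>x\<close> it is that of \<open>R\<close>, with the neighbours in
    \<open>S\<close> counted once more because \<open>f\<close> is 0 rather than 1 there.\<close>
  have "laplacian E f x < laplacian E f y"
    using laplacian_less[OF xy lip] fx fy by simp
  then have "real (card B) / real (card (E `` {y})) < real (card R + 1 + card (B \<inter> E `` {x})) / real (card (E `` {x}))"
    unfolding lx ly using pos by (simp add: field_simps)
  then have "real (card B) * real (card (E `` {x})) < real (card R + 1 + card (B \<inter> E `` {x})) * real (card (E `` {y}))"
    using pos by (simp add: field_simps)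
  then show ?thesis unfolding R_def S_def by (simp only: of_nat_mult[symmetric] of_nat_less_iff)
qed

end

text \<open>Each block of \<open>m\<close> consecutive indices has a constant quotient, so every
  factor from 1 to \<open>n\<close> occurs \<open>m\<close> times.\<close>

lemma prod_Suc_div: "(\<Prod>i<m * n. Suc (i div m)) = fact n ^ m" if "0 < m" for m n :: nat
proof (induction n)
  case (Suc n)
  have "(\<Prod>i<m * Suc n. Suc (i div m)) = (\<Prod>i\<in>{0..<m * n}. Suc (i div m)) * (\<Prod>i\<in>{0 + m * n..<m + m * n}. Suc (i div m))"
    using prod.atLeastLessThan_concat[of 0 "m * n" "m + m * n" "\<lambda>i. Suc (i div m)"]
    by (simp add: lessThan_atLeast0)
  also have "(\<Prod>i\<in>{0 + m * n..<m + m * n}. Suc (i div m)) = (\<Prod>i\<in>{0..<m}. Suc n)"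
    using that unfolding prod.shift_bounds_nat_ivl by (intro prod.cong) auto
  finally have "(\<Prod>i<m * Suc n. Suc (i div m)) = fact n ^ m * Suc n ^ m"
    using Suc by (simp add: lessThan_atLeast0)
  then show ?case by (simp only: fact_Suc of_nat_id power_mult_distrib mult.commute)
qed simp

section \<open>Distance levels around a root\<close>

locale bounded_positive_graph = positive_graph +
  fixes k :: nat
  assumes degree_pos: "v \<in> V \<Longrightarrow> 0 < card (E `` {v})"
    and degree_le: "v \<in> V \<Longrightarrow> card (E `` {v}) \<le> k"
    and k_pos: "0 < k"
begin

context
  fixes q :: 'a
  assumes qV: "q \<in> V"
begin

abbreviation (input) "lev v \<equiv> graph_dist E q v"

definition up :: "'a \<Rightarrow> 'a set" where "up v = {z \<in> E `` {v}. lev z = lev v + 1}"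
definition down :: "'a \<Rightarrow> 'a set" where "down v = {z \<in> E `` {v}. lev z + 1 = lev v}"
definition level :: "nat \<Rightarrow> 'a set" where "level r = {v \<in> V. lev v = r}"

lemma lev_edge: "(s, t) \<in> E \<Longrightarrow> lev t \<le> lev s + 1"
proof -
  assume st: "(s, t) \<in> E"
  have "(q, s) \<in> E ^^ lev s" using dist_walk[OF qV E_in_V(1)[OF st]] .
  then have "(q, t) \<in> E ^^ (lev s + 1)" using st by auto
  then show "lev t \<le> lev s + 1" by (rule graph_dist_le)
qed

lemma lev_root: "lev v = 0 \<Longrightarrow> v \<in> V \<Longrightarrow> v = q"
  using dist_walk[OF qV, of v] by simp

lemma parent:
  assumes "v \<in> V" "lev v = Suc r"
  obtains u where "(v, u) \<in> E" "lev u = r"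
proof -
  have "(q, v) \<in> E ^^ Suc r" using dist_walk[OF qV assms(1)] assms(2) by simp
  then obtain u where u: "(q, u) \<in> E ^^ r" "(u, v) \<in> E" by auto
  have "lev u \<le> r" using graph_dist_le[OF u(1)] .
  moreover have "Suc r \<le> lev u + 1" using lev_edge[OF u(2)] assms(2) by simp
  ultimately show thesis using that[of u] E_sym[OF u(2)] by simp
qed

lemma lev_lipschitz: "edge_lipschitz E (\<lambda>v. real (lev v))"
  unfolding edge_lipschitz_def
proof clarify
  fix s t assume "(s, t) \<in> E"
  then show "\<bar>real (lev s) - real (lev t)\<bar> \<le> 1" using lev_edge[of s t] lev_edge[OF E_sym[of s t]] by simp
qed

lemma fin: "v \<in> V \<Longrightarrow> finite (up v)" "v \<in> V \<Longrightarrow> finite (down v)"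
  unfolding up_def down_def by (rule finite_subset[OF _ locally_finite], blast, assumption)+

lemma laplacian_lev:
  assumes "v \<in> V"
  shows "laplacian E (\<lambda>v. real (lev v)) v = (real (card (up v)) - real (card (down v))) / real (card (E `` {v}))"
proof -
  have fE: "finite (E `` {v})" by (rule locally_finite[OF assms])
  have "(\<Sum>z\<in>E `` {v}. real (lev z) - real (lev v)) =
      (\<Sum>z\<in>E `` {v}. (if lev z = lev v + 1 then 1 else 0) - (if lev z + 1 = lev v then 1 else 0))"
  proof (rule sum.cong[OF refl])
    fix z assume "z \<in> E `` {v}"
    then have "lev z \<le> lev v + 1" "lev v \<le> lev z + 1" using lev_edge[of v z] lev_edge[OF E_sym[of v z]] by auto
    then consider "lev z = lev v + 1" | "lev z = lev v" | "lev z + 1 = lev v" by linarith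
    then show "real (lev z) - real (lev v) = (if lev z = lev v + 1 then 1 else 0) - (if lev z + 1 = lev v then 1 else 0)"
      by cases auto
  qed
  also have "\<dots> = real (card (up v)) - real (card (down v))"
    unfolding up_def down_def sum_subtractf sum_indicator_card[OF fE] ..
  finally show ?thesis unfolding laplacian_def by simp
qed

lemma up_down_card:
  assumes "v \<in> V"
  shows "card (up v) + card (down v) \<le> card (E `` {v})"
proof -
  have "up v \<inter> down v = {}" unfolding up_def down_def by auto
  then have "card (up v) + card (down v) = card (up v \<union> down v)" using fin[OF assms] by (simp add: card_Un_disjoint)
  also have "\<dots> \<le> card (E `` {v})" using locally_finite[OF assms] by (intro card_mono) (auto simp: up_def down_def)
  finally show ?thesis .
qed

text \<open>
  Distances are integers, so the strict decrease of the Laplacian along an edge is by a multiple of the inverse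
  of the product of the two degrees.
\<close>

lemma laplacian_level:
  assumes "v \<in> V"
  shows "laplacian E (\<lambda>v. real (lev v)) v \<le> 1 - real (lev v) / (real k)\<^sup>2"
  using assms
proof (induction "lev v" arbitrary: v)
  case 0
  have "real (card (up v)) - real (card (down v)) \<le> real (card (E `` {v}))" using up_down_card[OF 0(2)] by simp
  then show ?case unfolding laplacian_lev[OF 0(2)] using 0 degree_pos[OF 0(2)] by (simp add: divide_le_eq)
next
  case (Suc r)
  obtain u where u: "(v, u) \<in> E" "lev u = r" using parent[OF Suc(3) Suc(2)[symmetric]] by blast
  have uV: "u \<in> V" using E_in_V[OF u(1)] by blast
  have IH: "laplacian E (\<lambda>v. real (lev v)) u \<le> 1 - real r / (real k)\<^sup>2" using Suc(1)[OF u(2)[symmetric] uV] u(2) by simp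
  define a b c d where "a = int (card (up v)) - int (card (down v))" and "b = int (card (E `` {v}))"
    and "c = int (card (up u)) - int (card (down u))" and "d = int (card (E `` {u}))"
  have b: "0 < b" "b \<le> int k" and d: "0 < d" "d \<le> int k"
    using degree_pos[OF Suc(3)] degree_pos[OF uV] degree_le[OF Suc(3)] degree_le[OF uV] unfolding b_def d_def by auto
  have lv: "laplacian E (\<lambda>v. real (lev v)) v = real_of_int a / real_of_int b"
    and lu: "laplacian E (\<lambda>v. real (lev v)) u = real_of_int c / real_of_int d"
    unfolding laplacian_lev[OF Suc(3)] laplacian_lev[OF uV] a_def b_def c_def d_def by simp_all
  have "laplacian E (\<lambda>v. real (lev v)) v < laplacian E (\<lambda>v. real (lev v)) u"
    by (rule laplacian_less[OF u(1) lev_lipschitz]) (use u(2) Suc(2) in simp)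
  then have "real_of_int (a * d) < real_of_int (c * b)" unfolding lv lu using b d by (simp add: field_simps)
  then have "a * d + 1 \<le> c * b" by linarith
  then have "real_of_int (a * d + 1) \<le> real_of_int (c * b)" by (simp only: of_int_le_iff)
  then have "real_of_int a / real_of_int b + 1 / (real_of_int b * real_of_int d) \<le> real_of_int c / real_of_int d"
  proof -
    have "real_of_int a / real_of_int b + 1 / (real_of_int b * real_of_int d)
      = real_of_int (a * d + 1) / (real_of_int b * real_of_int d)"
      using b d by (simp add: add_divide_distrib)
    moreover have "real_of_int c / real_of_int d = real_of_int (c * b) / (real_of_int b * real_of_int d)"
      using b d by simp
    ultimately show ?thesis
      using \<open>real_of_int (a * d + 1) \<le> real_of_int (c * b)\<close> b d by (simp only: divide_right_mono mult_nonneg_nonneg of_int_0_le_iff less_imp_le)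
  qed
  moreover have "1 / (real k)\<^sup>2 \<le> 1 / (real_of_int b * real_of_int d)"
  proof (rule divide_left_mono)
    have "b * d \<le> int k * int k" using b d by (intro mult_mono) auto
    then have "real_of_int (b * d) \<le> real_of_int (int k * int k)" by (simp only: of_int_le_iff)
    then show "real_of_int b * real_of_int d \<le> (real k)\<^sup>2" by (simp add: power2_eq_square)
  qed (use b d k_pos in auto)
  moreover have "real (lev v) / (real k)\<^sup>2 = real r / (real k)\<^sup>2 + 1 / (real k)\<^sup>2"
    using Suc(2) by (simp add: add_divide_distrib[symmetric])
  ultimately show ?case using IH unfolding lv lu by linarith
qed

lemma lev_le:
  assumes "v \<in> V"
  shows "lev v \<le> 2 * k ^ 2"
proof -
  have "- real (card (E `` {v})) \<le> real (card (up v)) - real (card (down v))" using up_down_card[OF assms] by simp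
  then have "- 1 \<le> laplacian E (\<lambda>v. real (lev v)) v"
    unfolding laplacian_lev[OF assms] using degree_pos[OF assms] by (simp add: le_divide_eq)
  then have "real (lev v) / (real k)\<^sup>2 \<le> 2" using laplacian_level[OF assms] by linarith
  then have "real (lev v) \<le> real (2 * k ^ 2)" using k_pos by (simp add: divide_le_eq)
  then show ?thesis by (simp only: of_nat_le_iff)
qed

text \<open>The bound on the Laplacian is multiplied by the largest possible degree
  \<open>k\<close>. Beyond level \<open>k ^ 2\<close> the Laplacian is negative, in accordance with
  the value 0 of the truncated subtraction.\<close>

lemma up_le:
  assumes "v \<in> V"
  shows "card (up v) \<le> card (down v) + (k ^ 2 - lev v) div k"
proof (cases "card (up v) \<le> card (down v)")
  case False
  have "(real (card (up v)) - real (card (down v))) / real (card (E `` {v})) \<le> 1 - real (lev v) / (real k)\<^sup>2"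
    using laplacian_level[OF assms] unfolding laplacian_lev[OF assms] .
  moreover have "(real (card (up v)) - real (card (down v))) / real k
      \<le> (real (card (up v)) - real (card (down v))) / real (card (E `` {v}))"
    using False degree_pos[OF assms] degree_le[OF assms] by (intro divide_left_mono) auto
  ultimately have "(real (card (up v)) - real (card (down v))) / real k \<le> 1 - real (lev v) / (real k)\<^sup>2" by linarith
  then have "(real (card (up v)) - real (card (down v))) * real k \<le> (real k)\<^sup>2 - real (lev v)"
  proof -
    assume "(real (card (up v)) - real (card (down v))) / real k \<le> 1 - real (lev v) / (real k)\<^sup>2"
    then have "(real (card (up v)) - real (card (down v))) / real k * (real k)\<^sup>2 \<le> (1 - real (lev v) / (real k)\<^sup>2) * (real k)\<^sup>2"
      by (rule mult_right_mono) simp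
    moreover have "(1 - real (lev v) / (real k)\<^sup>2) * (real k)\<^sup>2 = (real k)\<^sup>2 - real (lev v)"
      using k_pos by (simp add: left_diff_distrib)
    moreover have "t / real k * (real k)\<^sup>2 = t * real k" for t
      using k_pos by (simp add: power2_eq_square)
    ultimately show ?thesis by simp
  qed
  then have "real (card (up v) * k + lev v) \<le> real (k ^ 2 + card (down v) * k)" by (simp add: algebra_simps)
  then have "card (up v) * k + lev v \<le> k ^ 2 + card (down v) * k" by (simp only: of_nat_le_iff)
  then have "(card (up v) - card (down v)) * k \<le> k ^ 2 - lev v" by (simp add: diff_mult_distrib)
  then have "card (up v) - card (down v) \<le> (k ^ 2 - lev v) div k" using k_pos by (simp add: less_eq_div_iff_mult_less_eq)
  then show ?thesis by linarith
qed simp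

lemma finite_level: "finite (level r)"
proof (induction r)
  case 0
  have "level 0 \<subseteq> {q}" using lev_root unfolding level_def by auto
  then show ?case by (rule finite_subset) simp
next
  case (Suc r)
  have "level (Suc r) \<subseteq> (\<Union>u\<in>level r. E `` {u})"
  proof
    fix v assume "v \<in> level (Suc r)"
    then have v: "v \<in> V" "lev v = Suc r" unfolding level_def by auto
    obtain u where "(v, u) \<in> E" "lev u = r" using parent[OF v] by blast
    then show "v \<in> (\<Union>u\<in>level r. E `` {u})" using E_sym E_in_V unfolding level_def by blast
  qed
  moreover have "finite (\<Union>u\<in>level r. E `` {u})" using Suc locally_finite unfolding level_def by auto
  ultimately show ?case by (rule finite_subset)
qed

text \<open>Edges between consecutive levels are counted, rather than vertices, because the
  Laplacian compares upward and downward edges at one vertex.\<close>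

definition rungs :: "nat \<Rightarrow> nat" where "rungs r = (\<Sum>v\<in>level r. card (up v))"

lemma rungs_down: "rungs r = (\<Sum>v\<in>level (Suc r). card (down v))"
proof -
  have "rungs r = card (Sigma (level r) up)"
    unfolding rungs_def using finite_level fin(1) by (subst card_SigmaI) (auto simp: level_def)
  also have "\<dots> = card ((\<lambda>(v, z). (z, v)) ` Sigma (level r) up)"
    by (intro card_image[symmetric]) (auto simp: inj_on_def)
  also have "(\<lambda>(v, z). (z, v)) ` Sigma (level r) up = Sigma (level (Suc r)) down"
    unfolding level_def up_def down_def using E_sym E_in_V by (auto simp: image_iff)
  also have "card \<dots> = (\<Sum>v\<in>level (Suc r). card (down v))"
    using finite_level fin(2) by (subst card_SigmaI) (auto simp: level_def)
  finally show ?thesis .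
qed

lemma down_pos: "v \<in> level (Suc r) \<Longrightarrow> 1 \<le> card (down v)"
proof -
  assume "v \<in> level (Suc r)"
  then have v: "v \<in> V" "lev v = Suc r" unfolding level_def by auto
  obtain u where "(v, u) \<in> E" "lev u = r" using parent[OF v] by blast
  then have "down v \<noteq> {}" unfolding down_def using v by auto
  then show "1 \<le> card (down v)" using fin(2)[OF v(1)] by (simp add: Suc_le_eq card_gt_0_iff)
qed

text \<open>Every vertex past the root has a downward edge, so the additive excess in
  \<open>up_le\<close> is at most that excess times the number of downward edges.\<close>

lemma rungs_Suc: "rungs (Suc r) \<le> rungs r * Suc ((k ^ 2 - Suc r) div k)"
proof -
  have "card (up v) \<le> card (down v) * Suc ((k ^ 2 - Suc r) div k)" if v: "v \<in> level (Suc r)" for v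
  proof -
    have "card (up v) \<le> card (down v) + (k ^ 2 - Suc r) div k"
      using up_le[of v] v unfolding level_def by auto
    also have "\<dots> \<le> card (down v) + card (down v) * ((k ^ 2 - Suc r) div k)"
      using down_pos[OF v] by simp
    finally show ?thesis by simp
  qed
  then show ?thesis
    unfolding rungs_down[of r] sum_distrib_right rungs_def[of "Suc r"] by (rule sum_mono)
qed

lemma rungs_le: "rungs r \<le> k * (\<Prod>i<r. Suc ((k ^ 2 - Suc i) div k))"
proof (induction r)
  case 0
  have "level 0 \<subseteq> {q}" using lev_root unfolding level_def by auto
  then have "rungs 0 \<le> (\<Sum>v\<in>{q}. card (up v))" unfolding rungs_def by (intro sum_mono2) auto
  also have "\<dots> \<le> k" using up_down_card[OF qV] degree_le[OF qV] by simp
  finally show ?case by simp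
next
  case (Suc r)
  have "rungs (Suc r) \<le> rungs r * Suc ((k ^ 2 - Suc r) div k)" by (rule rungs_Suc)
  also have "\<dots> \<le> (k * (\<Prod>i<r. Suc ((k ^ 2 - Suc i) div k))) * Suc ((k ^ 2 - Suc r) div k)"
    using Suc by (rule mult_right_mono) simp
  finally show ?case by (simp add: algebra_simps)
qed

text \<open>Beyond index \<open>k ^ 2\<close> the factors are 1, so the product never exceeds the
  one over all indices below \<open>k ^ 2\<close>. Reversing the index turns that one into a power
  of a factorial.\<close>

lemma rungs_bound: "rungs r \<le> k * fact k ^ k"
proof -
  have le: "(\<Prod>i<r. Suc ((k ^ 2 - Suc i) div k)) \<le> (\<Prod>i<k ^ 2. Suc ((k ^ 2 - Suc i) div k))"
  proof (cases "r \<le> k ^ 2")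
    case True
    then have "(\<Prod>i<r. Suc ((k ^ 2 - Suc i) div k)) dvd (\<Prod>i<k ^ 2. Suc ((k ^ 2 - Suc i) div k))"
      by (intro prod_dvd_prod_subset) auto
    then show ?thesis by (rule dvd_imp_le) (simp add: prod_pos)
  next
    case False
    then have "(\<Prod>i<k ^ 2. Suc ((k ^ 2 - Suc i) div k)) = (\<Prod>i<r. Suc ((k ^ 2 - Suc i) div k))"
      by (intro prod.mono_neutral_left) auto
    then show ?thesis by simp
  qed
  also have "\<dots> = (\<Prod>i<k * k. Suc (i div k))"
    using prod.nat_diff_reindex[of "\<lambda>i. Suc (i div k)" "k * k"] by (simp add: power2_eq_square)
  also have "\<dots> = fact k ^ k" using prod_Suc_div[OF k_pos] .
  finally show ?thesis using rungs_le[of r] mult_le_mono2 order_trans by blast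
qed

lemma card_level: "card (level r) \<le> Suc (k * fact k ^ k)"
proof (cases r)
  case 0
  have "level 0 \<subseteq> {q}" using lev_root unfolding level_def by auto
  then have "card (level 0) \<le> card {q}" by (intro card_mono) auto
  then show ?thesis using 0 by simp
next
  case (Suc s)
  have "card (level r) = (\<Sum>v\<in>level (Suc s). 1)" using Suc by simp
  also have "\<dots> \<le> (\<Sum>v\<in>level (Suc s). card (down v))" by (intro sum_mono down_pos)
  also have "\<dots> = rungs s" by (rule rungs_down[symmetric])
  finally show ?thesis using rungs_bound[of s] by simp
qed

lemma card_V: "finite V" "card V \<le> Suc (2 * k ^ 2) * Suc (k * fact k ^ k)"
proof -
  have V: "V = (\<Union>r\<le>2 * k ^ 2. level r)" using lev_le unfolding level_def by auto
  show "finite V" by (subst V) (use finite_level in blast)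
  have "card V \<le> (\<Sum>r\<le>2 * k ^ 2. card (level r))" by (subst V) (rule card_UN_le, simp)
  also have "\<dots> \<le> (\<Sum>r\<le>2 * k ^ 2. Suc (k * fact k ^ k))" by (intro sum_mono card_level)
  finally show "card V \<le> Suc (2 * k ^ 2) * Suc (k * fact k ^ k)" by simp
qed

end

end

lemma numeric_bound: "Suc (2 * 24 ^ 2) * Suc (24 * fact 24 ^ 24) \<le> (17::nat) ^ 544"
proof -
  \<comment> \<open>All factors are rounded up to powers of two: 11 for the 1153 levels, 5 for the
    factor 24 and the successor, and 80 * 24 for the factorials. The total exponent 1936 is 4 * 484,
    which gives 16^484.\<close>
  have "(fact 24 :: nat) \<le> 2 ^ 80" by (simp add: fact_numeral)
  then have "(fact 24 :: nat) ^ 24 \<le> (2 ^ 80) ^ 24" by (rule power_mono) simp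
  then have "Suc (24 * fact 24 ^ 24) \<le> 2 ^ 5 * (2 ^ 80) ^ 24" by simp
  moreover have "Suc (2 * 24 ^ 2) \<le> (2::nat) ^ 11" by simp
  ultimately have "Suc (2 * 24 ^ 2) * Suc (24 * fact 24 ^ 24) \<le> 2 ^ 11 * (2 ^ 5 * (2 ^ 80) ^ 24 :: nat)"
    by (intro mult_mono) auto
  also have "\<dots> = (2 ^ 4) ^ 484" unfolding power_mult[symmetric] power_add[symmetric] by simp
  also have "\<dots> \<le> (17::nat) ^ 484" by (rule power_mono) simp_all
  also have "\<dots> \<le> 17 ^ 544" by (rule power_increasing) simp_all
  finally show ?thesis .
qed

theorem theorem1p7:
  fixes V :: "'a set" and E :: "'a rel"
  assumes "simple_graph V E"
    and "connected_graph V E"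
    and "planar_graph V E"
    and "\<forall>x\<in>V. finite (neighborhood E x)"
    and "\<forall>x\<in>V. vertex_degree E x \<ge> 3"
    and "\<forall>(x, y)\<in>E. LLY_curvature E x y > 0"
  shows "finite V \<and> card V \<le> 17 ^ 544"
proof -
  obtain p c where drawing: "planar_drawing V E p c"
    using assms(3) unfolding planar_graph_def by blast
  have fin: "finite (E `` {v})" and deg: "3 \<le> card (E `` {v})" if "v \<in> V" for v
    using assms(4,5) that unfolding neighborhood_def vertex_degree_def by auto
  interpret positive_graph V E
    by unfold_locales (use assms fin in auto)
  have le: "card (E `` {x}) \<le> 24" if "x \<in> V" for x
  proof (rule ccontr)
    assume "\<not> ?thesis"
    then have "hub V E p c x"
      by unfold_locales (use drawing fin deg that neighbour_expansion in auto)
    then show False by (rule hub.degree_too_large)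
  qed
  interpret bounded_positive_graph V E 24
    by unfold_locales (use le deg in force)+
  show ?thesis
  proof (cases "V = {}")
    case False
    then obtain q where "q \<in> V" by blast
    from card_V[OF this] show ?thesis using numeric_bound le_trans by blast
  qed simp
qed

end
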